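(* Let $d\ge 1$ and let $\Sigma$ be a simplicial complex on $d+3$ vertices. Then $\Sigma$ embeds topologically into $\mathbb{R}^d$ if and only if it embeds linearly into $\mathbb{R}^d$; and $\Sigma$ embeds topologically into $S^d$ if and only if it embeds geodesically into $S^d$.
   Context: An embedding of a simplicial complex $\Sigma$ into $\mathbb{R}^d$ is linear if the image of each face of $\Sigma$ is the convex hull of the images of its vertices. An embedding of $\Sigma$ into the unit sphere $S^d\subset\mathbb{R}^{d+1}$ is geodesic if the image of each face is geodesically convex in $S^d$, i.e., for any two points in the image, any shortest path (in the round metric) connecting them lies in the image. *)

theory Defs
  imports "HOL-Analysis.Analysis"
begin

definition abstract_simplicial_complex :: "'v set \<Rightarrow> 'v set set \<Rightarrow> bool" where
  "abstract_simplicial_complex V K \<longleftrightarrow>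
     finite V \<and> K \<subseteq> Pow V \<and> (\<forall>v\<in>V. {v} \<in> K) \<and> (\<forall>\<sigma>\<in>K. \<forall>\<tau>. \<tau> \<subseteq> \<sigma> \<longrightarrow> \<tau> \<in> K)"

(* Points are given by barycentric coordinates; the type 'v => real carries the product
   topology, which induces the usual topology on the realization of a finite complex. *)
definition realized_face :: "'v set \<Rightarrow> ('v \<Rightarrow> real) set" where
  "realized_face \<sigma> = {x. (\<forall>v. 0 \<le> x v) \<and> (\<forall>v. v \<notin> \<sigma> \<longrightarrow> x v = 0) \<and> sum x \<sigma> = 1}"

definition realization :: "'v set set \<Rightarrow> ('v \<Rightarrow> real) set" where
  "realization K = (\<Union>\<sigma>\<in>K. realized_face \<sigma>)"

definition vertex_point :: "'v \<Rightarrow> 'v \<Rightarrow> real" where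
  "vertex_point v = (\<lambda>u. if u = v then 1 else 0)"

definition topological_embedding ::
    "'v set set \<Rightarrow> 'a::topological_space set \<Rightarrow> (('v \<Rightarrow> real) \<Rightarrow> 'a) \<Rightarrow> bool" where
  "topological_embedding K S f \<longleftrightarrow> embedding_map (top_of_set (realization K)) (top_of_set S) f"

(* Only the images of the faces are constrained: f need not be affine on a face. *)
definition linear_embedding ::
    "'v set set \<Rightarrow> (('v \<Rightarrow> real) \<Rightarrow> 'a::euclidean_space) \<Rightarrow> bool" where
  "linear_embedding K f \<longleftrightarrow> topological_embedding K UNIV f \<and>
     (\<forall>\<sigma>\<in>K. f ` realized_face \<sigma> = convex hull (f ` vertex_point ` \<sigma>))"

definition round_dist :: "'a::euclidean_space \<Rightarrow> 'a \<Rightarrow> real" where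
  "round_dist x y = arccos (x \<bullet> y)"

(* The supremum over all subdivisions t 0 <= ... <= t n of the parameter interval;
   it is infinite for non-rectifiable paths. *)
definition round_length :: "(real \<Rightarrow> 'a::euclidean_space) \<Rightarrow> ereal" where
  "round_length g =
     (SUP (n, t) \<in> (UNIV :: nat set) \<times> {t :: nat \<Rightarrow> real. mono t \<and> range t \<subseteq> {0..1}}.
        ereal (\<Sum>i<n. round_dist (g (t i)) (g (t (Suc i)))))"

definition sphere_path :: "'a::euclidean_space \<Rightarrow> 'a \<Rightarrow> (real \<Rightarrow> 'a) \<Rightarrow> bool" where
  "sphere_path x y g \<longleftrightarrow>
     path g \<and> path_image g \<subseteq> sphere 0 1 \<and> pathstart g = x \<and> pathfinish g = y"

definition shortest_sphere_path :: "'a::euclidean_space \<Rightarrow> 'a \<Rightarrow> (real \<Rightarrow> 'a) \<Rightarrow> bool" where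
  "shortest_sphere_path x y g \<longleftrightarrow>
     sphere_path x y g \<and> (\<forall>h. sphere_path x y h \<longrightarrow> round_length g \<le> round_length h)"

(* All shortest paths count: a set containing two antipodal points must contain every
   great semicircle joining them. *)
definition geodesically_convex :: "'a::euclidean_space set \<Rightarrow> bool" where
  "geodesically_convex S \<longleftrightarrow> S \<subseteq> sphere 0 1 \<and>
     (\<forall>x\<in>S. \<forall>y\<in>S. \<forall>g. shortest_sphere_path x y g \<longrightarrow> path_image g \<subseteq> S)"

definition geodesic_embedding ::
    "'v set set \<Rightarrow> (('v \<Rightarrow> real) \<Rightarrow> 'a::euclidean_space) \<Rightarrow> bool" where
  "geodesic_embedding K f \<longleftrightarrow> topological_embedding K (sphere 0 1) f \<and>
     (\<forall>\<sigma>\<in>K. geodesically_convex (f ` realized_face \<sigma>))"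

end

(*
  If K embeds in the d-sphere (or in R^d), then there is a set A of vertices such that neither A nor
  V - A is a face (Sarkaria's argument). Otherwise take z in the (d+2)-sphere of R^V with positive and
  negative parts z+ and z-; one of the two supports is always a face. The difference of the distances
  of z and -z to the set of points whose positive part is supported on a face is an odd function that
  vanishes only if both supports are faces, and then |z+| F(z+ / |z+|) - |z-| F(z- / |z-|) is
  nonzero, where F is the embedding (completed by a coordinate 1 in the case of R^d). This gives an
  odd map without zeros from the (d+2)-sphere to R^(d+2), contradicting the Borsuk-Ulam theorem.

  Conversely, if A and B = V - A are not faces, then K is a subcomplex of the join of the boundaries of
  the simplices A and B, which is the boundary of a simplicial (d+1)-polytope; radial projection gives
  the geodesic embedding. If K is the whole join, it does not embed in R^d; otherwise some V - {p, q}
  with p in A and q in B is not a face, and a Schlegel diagram based at it gives the linear embedding.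

  For Borsuk-Ulam, suppose that f_0, ..., f_(n-1) are odd on the n-sphere without common zero, and let
  e_i be the 0-1-valued sign of f_i with an antipodally antisymmetric choice at the zeros. Since the
  homology below degree n vanishes, there are chains h_k with h_0 a point and boundary of h_(k+1) equal
  to h_k plus or minus its antipode. The cup product of the coboundaries of e_0, ..., e_(k-1) has the
  same parity on all h_k, hence is odd on h_n. After subdivision, however, some f_i has constant
  sign on each simplex of h_n, so the product is zero.
*)
theory Submission
  imports Defs "HOL-Homology.Homology"
begin

section \<open>The Borsuk-Ulam theorem\<close>

text \<open>\<open>frag_extend\<close> takes values only in free abelian groups, so the integers are
  represented as the free abelian group on the single generator \<open>()\<close>.\<close>

definition cochain_eval :: "('s \<Rightarrow> int) \<Rightarrow> ('s \<Rightarrow>\<^sub>0 int) \<Rightarrow> int" where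
  "cochain_eval a c = Poly_Mapping.lookup (frag_extend (\<lambda>s. frag_cmul (a s) (frag_of ())) c) ()"

lemma cochain_eval_of [simp]: "cochain_eval a (frag_of s) = a s"
  by (simp add: cochain_eval_def)

lemma cochain_eval_0 [simp]: "cochain_eval a 0 = 0"
  by (simp add: cochain_eval_def)

lemma cochain_eval_add: "cochain_eval a (c + d) = cochain_eval a c + cochain_eval a d"
  by (simp add: cochain_eval_def frag_extend_add lookup_add)

lemma cochain_eval_diff: "cochain_eval a (c - d) = cochain_eval a c - cochain_eval a d"
  by (simp add: cochain_eval_def frag_extend_diff lookup_minus)

lemma cochain_eval_cmul: "cochain_eval a (frag_cmul n c) = n * cochain_eval a c"
  by (simp add: cochain_eval_def frag_extend_cmul)

lemma cochain_eval_sum: "finite I \<Longrightarrow> cochain_eval a (\<Sum>i\<in>I. f i) = (\<Sum>i\<in>I. cochain_eval a (f i))"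
  by (induction I rule: finite_induct) (auto simp: cochain_eval_add)

lemma cochain_eval_eq_0:
  assumes "\<And>s. s \<in> Poly_Mapping.keys c \<Longrightarrow> a s = 0"
  shows "cochain_eval a c = 0"
proof -
  have "Poly_Mapping.keys c \<subseteq> {s. a s = 0}"
    using assms by blast
  then show ?thesis
    by (induction c rule: frag_induction) (auto simp: cochain_eval_diff)
qed

text \<open>For 0-cochains \<open>e i\<close>, this is the cup product of the coboundaries of \<open>e 0, \<dots>, e (k - 1)\<close>
  on the ordered simplex with vertices \<open>v 0, \<dots>, v k\<close>.\<close>

definition sign_cup :: "nat \<Rightarrow> (nat \<Rightarrow> 'a \<Rightarrow> int) \<Rightarrow> (nat \<Rightarrow> 'a) \<Rightarrow> int" where
  "sign_cup k e v = (\<Prod>i<k. e i (v (Suc i)) - e i (v i))"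

lemma sign_cup_0 [simp]: "sign_cup 0 e v = 1"
  by (simp add: sign_cup_def)

lemma sign_cup_Suc: "sign_cup (Suc k) e v = sign_cup k e v * (e k (v (Suc k)) - e k (v k))"
  by (simp add: sign_cup_def)

lemma sign_cup_Suc_shift:
  "sign_cup (Suc k) e v = (e 0 (v 1) - e 0 (v 0)) * sign_cup k (\<lambda>i. e (Suc i)) (\<lambda>i. v (Suc i))"
  unfolding sign_cup_def by (subst prod.lessThan_Suc_shift) simp

text \<open>The Leibniz rule; only the coboundary of the last factor \<open>e k\<close> survives.\<close>

lemma coboundary_sign_cup:
  "(\<Sum>j\<le>Suc k. (-1) ^ j * (sign_cup k e (\<lambda>i. v (if i < j then i else Suc i)) * e k (v (if k < j then k else Suc k))))
   = (-1) ^ k * sign_cup (Suc k) e v"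
proof (induction k arbitrary: e v)
  case 0
  show ?case by (simp add: sign_cup_Suc)
next
  case (Suc k)
  let ?e = "\<lambda>i. e (Suc i)" and ?v = "\<lambda>i. v (Suc i)"
  define T where "T j w = sign_cup k ?e (\<lambda>i. w (if i < j then i else Suc i)) * ?e k (w (if k < j then k else Suc k))" for j and w :: "nat \<Rightarrow> 'a"
  define a where "a = T 0 ?v"
  define S where "S j = sign_cup (Suc k) e (\<lambda>i. v (if i < j then i else Suc i)) * e (Suc k) (v (if Suc k < j then Suc k else Suc (Suc k)))" for j
  \<comment> \<open>The faces opposite the vertices 0 and 1 differ only in their initial vertex,
    hence share the factor \<open>a\<close>. The difference \<open>S 0 - S 1\<close> is
    \<open>- (e 0 (v 1) - e 0 (v 0)) * a\<close> and restores the term for index 0 that is split off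
    from the induction hypothesis.\<close>
  have S0: "S 0 = (e 0 (v 2) - e 0 (v 1)) * a"
    by (simp add: S_def a_def T_def sign_cup_Suc_shift numeral_2_eq_2)
  have S1: "S 1 = (e 0 (v 2) - e 0 (v 0)) * a"
    by (simp add: S_def a_def T_def sign_cup_Suc_shift numeral_2_eq_2)
  have SS: "S (Suc (Suc j)) = (e 0 (v 1) - e 0 (v 0)) * T (Suc j) ?v" for j
  proof -
    have *: "(\<lambda>i. v (if i < Suc j then Suc i else Suc (Suc i))) = (\<lambda>i. v (Suc (if i < Suc j then i else Suc i)))"
      by auto
    show ?thesis
      by (simp add: S_def T_def sign_cup_Suc_shift * mult.assoc)
  qed
  have IH: "(\<Sum>j\<le>Suc k. (-1) ^ j * T j ?v) = (-1) ^ k * sign_cup (Suc k) ?e ?v"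
    using Suc.IH[of ?e ?v] by (simp add: T_def)
  have "(\<Sum>j\<le>Suc (Suc k). (-1) ^ j * S j) = S 0 + (\<Sum>j\<le>Suc k. (-1) ^ Suc j * S (Suc j))"
    by (subst sum.atMost_Suc_shift) simp
  also have "\<dots> = S 0 - S 1 + (\<Sum>j\<le>k. (-1) ^ j * S (Suc (Suc j)))"
    by (subst sum.atMost_Suc_shift) (simp add: sum_negf)
  also have "(\<Sum>j\<le>k. (-1) ^ j * S (Suc (Suc j))) = - (e 0 (v 1) - e 0 (v 0)) * (\<Sum>j\<le>k. (-1) ^ Suc j * T (Suc j) ?v)"
    by (subst sum_distrib_left) (auto simp: SS algebra_simps intro!: sum.cong)
  also have "(\<Sum>j\<le>k. (-1) ^ Suc j * T (Suc j) ?v) = (-1) ^ k * sign_cup (Suc k) ?e ?v - a"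
    using IH by (subst (asm) sum.atMost_Suc_shift) (simp add: a_def)
  finally have "(\<Sum>j\<le>Suc (Suc k). (-1) ^ j * S j) = S 0 - S 1 +
    - (e 0 (v 1) - e 0 (v 0)) * ((-1) ^ k * sign_cup (Suc k) ?e ?v - a)" .
  then have "(\<Sum>j\<le>Suc (Suc k). (-1) ^ j * S j) = (-1) ^ Suc k * sign_cup (Suc (Suc k)) e v"
    unfolding S0 S1 by (simp del: sum.atMost_Suc add: sign_cup_Suc_shift[of "Suc k"] algebra_simps)
  then show ?case by (simp add: S_def)
qed

section \<open>The cup product as a singular cochain\<close>

lemma simplicial_vertex_singular_face:
  assumes "i \<le> k" "j \<le> Suc k"
  shows "simplicial_vertex i (singular_face (Suc k) j s) = simplicial_vertex (if i < j then i else Suc i) s"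
proof -
  have "simplical_face j (\<lambda>l. if l = i then 1 else 0) = (\<lambda>l. if l = (if i < j then i else Suc i) then 1 else (0::real))"
    by (rule ext) (auto simp: simplical_face_def)
  then show ?thesis
    using assms by (simp add: simplicial_vertex_def singular_face_def)
qed

lemma simplicial_vertex_simplex_map:
  "i \<le> k \<Longrightarrow> simplicial_vertex i (simplex_map k g s) = g (simplicial_vertex i s)"
  by (simp add: simplicial_vertex_def simplex_map_def)

definition cup_delta :: "(nat \<Rightarrow> 'a \<Rightarrow> int) \<Rightarrow> nat \<Rightarrow> ((nat \<Rightarrow> real) \<Rightarrow> 'a) \<Rightarrow> int" where
  "cup_delta e k s = sign_cup k e (\<lambda>i. simplicial_vertex i s)"

text \<open>The cup product of \<open>cup_delta e k\<close> with the 0-cochain \<open>e k\<close>.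
  Up to sign it is a primitive of \<open>cup_delta e (Suc k)\<close>.\<close>

definition cup_delta_end :: "(nat \<Rightarrow> 'a \<Rightarrow> int) \<Rightarrow> nat \<Rightarrow> ((nat \<Rightarrow> real) \<Rightarrow> 'a) \<Rightarrow> int" where
  "cup_delta_end e k s = cup_delta e k s * e k (simplicial_vertex k s)"

lemma sign_cup_cong: "(\<And>i. i \<le> k \<Longrightarrow> v i = w i) \<Longrightarrow> sign_cup k e v = sign_cup k e w"
  by (simp add: sign_cup_def)

text \<open>On a single simplex this is \<open>coboundary_sign_cup\<close> for its vertices; both
  sides are additive in the chain.\<close>

lemma eval_cup_delta_end_boundary:
  assumes "singular_chain (Suc k) X c"
  shows "cochain_eval (cup_delta_end e k) (chain_boundary (Suc k) c) = (-1) ^ k * cochain_eval (cup_delta e (Suc k)) c"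
  using assms unfolding singular_chain_def
proof (induction c rule: frag_induction)
  case (one s)
  have "cup_delta_end e k (singular_face (Suc k) j s) = sign_cup k e (\<lambda>i. simplicial_vertex (if i < j then i else Suc i) s)
      * e k (simplicial_vertex (if k < j then k else Suc k) s)" if "j \<le> Suc k" for j
    using that unfolding cup_delta_end_def cup_delta_def
    by (auto simp: simplicial_vertex_singular_face intro!: arg_cong2[where f="(*)"] sign_cup_cong)
  then have "cochain_eval (cup_delta_end e k) (chain_boundary (Suc k) (frag_of s)) =
    (\<Sum>j\<le>Suc k. (-1) ^ j * (sign_cup k e (\<lambda>i. simplicial_vertex (if i < j then i else Suc i) s)
      * e k (simplicial_vertex (if k < j then k else Suc k) s)))"
    by (simp add: chain_boundary_of cochain_eval_sum cochain_eval_cmul cochain_eval_add del: sum.atMost_Suc)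
  then show ?case
    using coboundary_sign_cup[of k e "\<lambda>i. simplicial_vertex i s"] by (simp add: cup_delta_def)
next
  case (diff a b)
  then show ?case
    by (simp add: chain_boundary_diff cochain_eval_diff algebra_simps)
qed auto

text \<open>Replacing each \<open>e i\<close> by \<open>1 - e i\<close> reverses the sign of each of
  the \<open>k\<close> differences in the product.\<close>

lemma cup_delta_simplex_map:
  assumes "\<And>i x. x \<in> topspace X \<Longrightarrow> e i (g x) = 1 - e i x" "singular_simplex k X s"
  shows "cup_delta e k (simplex_map k g s) = (-1) ^ k * cup_delta e k s"
    "e k (simplicial_vertex k (simplex_map k g s)) = 1 - e k (simplicial_vertex k s)"
proof -
  have vt: "simplicial_vertex i s \<in> topspace X" if "i \<le> k" for i
    using assms(2) that
    by (auto simp: singular_simplex_def continuous_map_def simplicial_vertex_def Pi_iff)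
  have "cup_delta e k (simplex_map k g s) = (\<Prod>i<k. (-1) * (e i (simplicial_vertex (Suc i) s) - e i (simplicial_vertex i s)))"
    unfolding cup_delta_def sign_cup_def
    by (intro prod.cong) (auto simp: simplicial_vertex_simplex_map assms vt)
  also have "\<dots> = (-1) ^ k * cup_delta e k s"
    unfolding cup_delta_def sign_cup_def prod.distrib by simp
  finally show "cup_delta e k (simplex_map k g s) = (-1) ^ k * cup_delta e k s" .
  show "e k (simplicial_vertex k (simplex_map k g s)) = 1 - e k (simplicial_vertex k s)"
    by (simp add: simplicial_vertex_simplex_map assms vt)
qed

text \<open>The last factor \<open>e k\<close> turns into \<open>1 - e k\<close>. The constant 1
  contributes the \<open>cup_delta\<close> term, which carries the parity in the induction over the
  degree.\<close>

lemma eval_cup_delta_end_chain_map: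
  assumes "\<And>i x. x \<in> topspace X \<Longrightarrow> e i (g x) = 1 - e i x" and "singular_chain k X c"
  shows "cochain_eval (cup_delta_end e k) (chain_map k g c) = (-1) ^ k * (cochain_eval (cup_delta e k) c - cochain_eval (cup_delta_end e k) c)"
  using assms(2) unfolding singular_chain_def
proof (induction c rule: frag_induction)
  case (one s)
  then show ?case
    using cup_delta_simplex_map[of X e g k s] assms(1)
    by (simp add: cup_delta_end_def right_diff_distrib)
next
  case (diff a b)
  then show ?case
    by (simp add: chain_map_diff cochain_eval_diff algebra_simps)
qed auto

section \<open>Chains adapted to an involution\<close>

lemma frag_cmul_diff_distrib2: "frag_cmul k (a - b) = frag_cmul k a - frag_cmul k b"
  by (metis add_diff_cancel_right' diff_add_cancel frag_cmul_distrib2)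

text \<open>Each right-hand side is a cycle, because \<open>g\<close> is an involution and the signs
  alternate. It bounds by path-connectedness in degree 0 and by the vanishing of homology in the
  higher degrees.\<close>

lemma exists_equivariant_chains:
  assumes "continuous_map X X g" and g: "\<And>x. x \<in> topspace X \<Longrightarrow> g (g x) = x"
    and X: "path_connected_space X" "topspace X \<noteq> {}"
    and H: "\<And>k. 0 < k \<Longrightarrow> k < n \<Longrightarrow> trivial_group (homology_group (int k) X)"
  obtains h where "\<And>k. k \<le> n \<Longrightarrow> singular_chain k X (h k)"
    "\<And>k. k < n \<Longrightarrow> chain_boundary (Suc k) (h (Suc k)) = h k - frag_cmul ((-1) ^ k) (chain_map k g (h k))"
    "\<exists>s. h 0 = frag_of s"
proof -
  have *: "\<exists>h. (\<forall>k\<le>m. singular_chain k X (h k)) \<and> (\<exists>s. h 0 = frag_of s) \<and>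
    (\<forall>k<m. chain_boundary (Suc k) (h (Suc k)) = h k - frag_cmul ((-1) ^ k) (chain_map k g (h k)))" if "m \<le> n" for m
    using that
  proof (induction m)
    case 0
    obtain x where "x \<in> topspace X" using X(2) by blast
    then have "singular_simplex 0 X (\<lambda>_\<in>standard_simplex 0. x)"
      by (simp add: singular_simplex_def)
    then show ?case
      by (intro exI[of _ "\<lambda>_. frag_of (\<lambda>_\<in>standard_simplex 0. x)"]) (auto simp: singular_chain_of)
  next
    case (Suc m)
    then obtain h where h: "\<And>k. k\<le>m \<Longrightarrow> singular_chain k X (h k)" "\<exists>s. h 0 = frag_of s"
      "\<And>k. k<m \<Longrightarrow> chain_boundary (Suc k) (h (Suc k)) = h k - frag_cmul ((-1) ^ k) (chain_map k g (h k))"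
      by (auto simp: Suc_le_eq)
    let ?c = "h m - frag_cmul ((-1) ^ m) (chain_map m g (h m))"
    have sc: "singular_chain m X (chain_map m g (h m))"
      using h(1)[of m] assms(1) singular_chain_chain_map by blast
    have "\<exists>d. singular_chain (Suc m) X d \<and> chain_boundary (Suc m) d = ?c"
    proof (cases m)
      case 0
      obtain s where s: "h 0 = frag_of s" using h(2) by blast
      then have ss: "singular_simplex 0 X s"
        using h(1)[of 0] by (simp add: singular_chain_of)
      then have "singular_simplex 0 X (simplex_map 0 g s)"
        using assms(1) singular_simplex_simplex_map by blast
      \<comment> \<open>Any two 0-simplices of a path-connected space are homologous.\<close>
      from iso_integer_zeroth_homology_group_aux[OF X(1) ss this]
      show ?thesis
        by (simp add: 0 s homologous_rel_def singular_boundary)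
    next
      case (Suc k)
      have b: "chain_boundary m (h m) = h k - frag_cmul ((-1) ^ k) (chain_map k g (h k))"
        using h(3)[of k] Suc by simp
      have sk: "singular_chain k X (h k)" using h(1)[of k] Suc by simp
      have gg: "chain_map k g (chain_map k g (h k)) = h k"
      proof -
        have "chain_map k (g \<circ> g) (h k) = h k"
          by (rule chain_map_id_gen[OF sk]) (use g in auto)
        then show ?thesis by (simp add: chain_map_compose)
      qed
      have "chain_boundary m (chain_map m g (h m)) = chain_map k g (chain_boundary m (h m))"
        using chain_boundary_chain_map[OF h(1)[OF order_refl], of g] Suc by simp
      also have "\<dots> = chain_map k g (h k) - frag_cmul ((-1) ^ k) (h k)"
        unfolding b by (simp add: chain_map_diff gg)
      finally have bg: "chain_boundary m (chain_map m g (h m)) = chain_map k g (h k) - frag_cmul ((-1) ^ k) (h k)" .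
      \<comment> \<open>The signs \<open>(-1) ^ m\<close> and \<open>(-1) ^ k\<close> are opposite
        since \<open>m = Suc k\<close>, so the terms of \<open>b\<close> and \<open>bg\<close>
        cancel in pairs.\<close>
      have "chain_boundary m ?c = 0"
        unfolding chain_boundary_diff chain_boundary_cmul b bg
        by (simp add: Suc frag_cmul_diff_distrib2)
      then have cyc: "singular_relcycle m X {} ?c"
        using h(1)[of m] sc by (simp add: singular_cycle singular_chain_diff singular_chain_cmul)
      have "trivial_group (homology_group (int m) X)"
        using H[of m] Suc Suc.prems by simp
      then have "homologous_rel_set m X {} ?c = singular_relboundary_set m X {}"
        using imageI[of ?c "singular_relcycle_set m X {}" "homologous_rel_set m X {}"] cyc
        unfolding trivial_group_def carrier_relative_homology_group one_relative_homology_group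
        by (metis mem_Collect_eq singletonD)
      then show ?thesis
        by (simp add: homologous_rel_set_eq_relboundary singular_boundary)
    qed
    then obtain d where d: "singular_chain (Suc m) X d" "chain_boundary (Suc m) d = ?c" by blast
    show ?case
      by (rule exI[of _ "h(Suc m := d)"]) (use h d in \<open>auto simp: le_Suc_eq less_Suc_eq\<close>)
  qed
  show ?thesis using *[OF order_refl] that by blast
qed


section \<open>Iterated subdivision and the parity argument\<close>

lemma chain_boundary_iterated_subdivision:
  assumes "singular_chain p X c"
  shows "singular_chain p X ((singular_subdivision p ^^ m) c)"
    and "chain_boundary p ((singular_subdivision p ^^ m) c) = (singular_subdivision (p - Suc 0) ^^ m) (chain_boundary p c)"
    and "(singular_subdivision p ^^ m) (chain_map p g c) = chain_map p g ((singular_subdivision p ^^ m) c)"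
proof -
  show sc: "singular_chain p X ((singular_subdivision p ^^ m) c)" for m
    using assms by (induction m) (auto simp: singular_chain_singular_subdivision)
  show "chain_boundary p ((singular_subdivision p ^^ m) c) = (singular_subdivision (p - Suc 0) ^^ m) (chain_boundary p c)"
    by (induction m) (auto simp: chain_boundary_singular_subdivision[OF sc])
  show "(singular_subdivision p ^^ m) (chain_map p g c) = chain_map p g ((singular_subdivision p ^^ m) c)"
    by (induction m) (auto simp: naturality_singular_subdivision[OF sc])
qed

lemma singular_subdivision_0_dim:
  assumes "singular_chain 0 X c"
  shows "singular_subdivision 0 c = c"
  using assms singular_subdivision_zero by blast

text \<open>The sphere enters only through path-connectedness and vanishing homology in the degrees
  strictly between 0 and \<open>n\<close>, which keeps the argument independent of the model of the
  sphere.\<close>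

lemma Borsuk_Ulam_involution:
  fixes f :: "nat \<Rightarrow> 'a \<Rightarrow> real"
  assumes cg: "continuous_map X X g" and g: "\<And>x. x \<in> topspace X \<Longrightarrow> g (g x) = x"
    and X: "path_connected_space X" "topspace X \<noteq> {}"
    and H: "\<And>k. 0 < k \<Longrightarrow> k < n \<Longrightarrow> trivial_group (homology_group (int k) X)"
    and f: "\<And>i. i < n \<Longrightarrow> continuous_map X euclideanreal (f i)"
    and odd: "\<And>i x. i < n \<Longrightarrow> x \<in> topspace X \<Longrightarrow> f i (g x) = - f i x"
  shows "\<exists>x\<in>topspace X. \<forall>i<n. f i x = 0"
proof (rule ccontr)
  assume "\<not> ?thesis"
  then have nz: "\<exists>i<n. f i x \<noteq> 0" if "x \<in> topspace X" for x using that by blast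
  define q where "q x = (LEAST i. i < n \<and> f i x \<noteq> 0)" for x
  have q: "q x < n" "f (q x) x \<noteq> 0" if "x \<in> topspace X" for x
    using LeastI_ex[OF nz[OF that]] by (auto simp: q_def)
  have gX: "g x \<in> topspace X" if "x \<in> topspace X" for x
    using cg that by (auto simp: continuous_map_def)
  have qg: "q (g x) = q x" if "x \<in> topspace X" for x
    unfolding q_def by (rule arg_cong[where f=Least]) (use odd that in auto)
  \<comment> \<open>Where \<open>f i\<close> vanishes, the sign is borrowed from the first function
    that is nonzero at the point; this choice is the same at \<open>x\<close> and
    \<open>g x\<close>. For \<open>i \<ge> n\<close> the same default makes \<open>eg\<close> hold
    for every index.\<close>
  define r where "r i x = (if i < n \<and> f i x \<noteq> 0 then i else q x)" for i x
  define e :: "nat \<Rightarrow> 'a \<Rightarrow> int" where "e i x = (if f (r i x) x > 0 then 1 else 0)" for i x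
  have rg: "r i (g x) = r i x" "r i x < n" "f (r i x) x \<noteq> 0" if "x \<in> topspace X" for i x
    using that qg odd q by (auto simp: r_def)
  have eg: "e i (g x) = 1 - e i x" if "x \<in> topspace X" for i x
    using rg[OF that, of i] odd[OF rg(2)[OF that, of i] that] by (auto simp: e_def)
  obtain h where h: "\<And>k. k \<le> n \<Longrightarrow> singular_chain k X (h k)"
    "\<And>k. k < n \<Longrightarrow> chain_boundary (Suc k) (h (Suc k)) = h k - frag_cmul ((-1) ^ k) (chain_map k g (h k))"
    "\<exists>s. h 0 = frag_of s"
    using exists_equivariant_chains[OF cg g X H] by metis
  \<comment> \<open>On a simplex inside one of these sets, the corresponding factor of the cup product is zero.\<close>
  define U where "U = (\<lambda>(i, b). {x \<in> topspace X. (if b then f i x else - f i x) \<in> {0<..}})"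
  have opU: "openin X V" if V: "V \<in> U ` ({..<n} \<times> UNIV)" for V
  proof -
    obtain i b where "i < n" "V = U (i, b)" using V by blast
    have "continuous_map X euclideanreal (\<lambda>x. if b then f i x else - f i x)"
      using f[OF \<open>i < n\<close>] by (cases b) (auto intro!: continuous_map_minus)
    from openin_continuous_map_preimage[OF this, of "{0<..}"]
    have "openin X {x \<in> topspace X. (if b then f i x else - f i x) \<in> {0<..}}" by simp
    then show ?thesis by (simp only: \<open>V = U (i, b)\<close> U_def prod.case)
  qed
  have covU: "topspace X \<subseteq> \<Union> (U ` ({..<n} \<times> UNIV))"
  proof
    fix x assume x: "x \<in> topspace X"
    then have "x \<in> U (q x, f (q x) x > 0)" "q x < n"
      using q[OF x] by (auto simp: U_def)
    then show "x \<in> \<Union> (U ` ({..<n} \<times> UNIV))" by blast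
  qed
  \<comment> \<open>Iterated subdivision makes the simplices small with respect to the open
    cover.\<close>
  obtain m where m: "\<And>s. s \<in> Poly_Mapping.keys ((singular_subdivision n ^^ m) (h n)) \<Longrightarrow>
      \<exists>V \<in> U ` ({..<n} \<times> UNIV). s \<in> standard_simplex n \<rightarrow> V"
    using sufficient_iterated_singular_subdivision_exists[OF opU covU h(1)[OF order_refl]] by (metis order_refl)
  define h' where "h' k = (singular_subdivision k ^^ m) (h k)" for k
  have h'1: "singular_chain k X (h' k)" if "k \<le> n" for k
    unfolding h'_def using chain_boundary_iterated_subdivision(1) h(1) that by blast
  \<comment> \<open>The rule for differences with first term 0 gives compatibility with negation,
    and \<open>(-1) ^ l\<close> is 1 or -1.\<close>
  have sub_cmul: "(singular_subdivision k ^^ m) (frag_cmul ((-1) ^ l) c) = frag_cmul ((-1) ^ l) ((singular_subdivision k ^^ m) c)" for k l m and c :: "'a chain"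
    using singular_subdivision_power_diff[where p = k and n = m and a = 0 and b = c] by (cases "even l") auto
  have h'2: "chain_boundary (Suc k) (h' (Suc k)) = h' k - frag_cmul ((-1) ^ k) (chain_map k g (h' k))" if "k < n" for k
  proof -
    have "chain_boundary (Suc k) (h' (Suc k)) = (singular_subdivision k ^^ m) (chain_boundary (Suc k) (h (Suc k)))"
      unfolding h'_def using chain_boundary_iterated_subdivision(2)[OF h(1)[of "Suc k"]] that by simp
    also have "\<dots> = h' k - frag_cmul ((-1) ^ k) ((singular_subdivision k ^^ m) (chain_map k g (h k)))"
      using that by (simp add: h(2) singular_subdivision_power_diff sub_cmul h'_def)
    finally show ?thesis
      using chain_boundary_iterated_subdivision(3)[OF h(1)[of k], where g = g and m = m] that by (simp add: h'_def)
  qed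
  have h'0: "h' 0 = h 0"
  proof -
    have "(singular_subdivision 0 ^^ m) (h 0) = h 0"
      by (induction m) (use h(1)[of 0] singular_subdivision_0_dim in auto)
    then show ?thesis by (simp add: h'_def)
  qed
  have odd_cup: "odd (cochain_eval (cup_delta e k) (h' k))" if "k \<le> n" for k
    using that
  proof (induction k)
    case 0
    then show ?case using h(3) by (auto simp: h'0 cup_delta_def)
  next
    case (Suc k)
    \<comment> \<open>With D and E the values of \<open>cup_delta e k\<close> and
      \<open>cup_delta_end e k\<close> on \<open>h' k\<close>, the boundary relation gives E - (D -
      E) = 2 E - D, which has the parity of D.\<close>
    have "(-1) ^ k * cochain_eval (cup_delta e (Suc k)) (h' (Suc k)) = cochain_eval (cup_delta_end e k) (chain_boundary (Suc k) (h' (Suc k)))"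
      using eval_cup_delta_end_boundary[OF h'1[OF Suc.prems]] by simp
    also have "\<dots> = cochain_eval (cup_delta_end e k) (h' k) - (cochain_eval (cup_delta e k) (h' k) - cochain_eval (cup_delta_end e k) (h' k))"
      using h'2[of k] Suc.prems eval_cup_delta_end_chain_map[of X e g k "h' k", OF eg h'1]
      by (simp add: cochain_eval_diff cochain_eval_cmul)
    finally have "(-1) ^ k * cochain_eval (cup_delta e (Suc k)) (h' (Suc k)) = 2 * cochain_eval (cup_delta_end e k) (h' k) - cochain_eval (cup_delta e k) (h' k)"
      by simp
    moreover have "odd (cochain_eval (cup_delta e k) (h' k))" using Suc by simp
    ultimately have "odd ((-1) ^ k * cochain_eval (cup_delta e (Suc k)) (h' (Suc k)))" by simp
    then show ?case by simp
  qed
  have "cup_delta e n s = 0" if s: "s \<in> Poly_Mapping.keys (h' n)" for s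
  proof -
    obtain i b where ib: "i < n" "s \<in> standard_simplex n \<rightarrow> U (i, b)"
      using m[of s] s unfolding h'_def by blast
    then have "simplicial_vertex j s \<in> U (i, b)" if "j \<le> n" for j
      using that by (auto simp: simplicial_vertex_def)
    then have "simplicial_vertex (Suc i) s \<in> U (i, b)" "simplicial_vertex i s \<in> U (i, b)"
      using ib by auto
    then have "e i (simplicial_vertex (Suc i) s) = e i (simplicial_vertex i s)"
      using ib(1) by (auto simp: U_def e_def r_def split: if_splits)
    then show ?thesis
      using ib(1) unfolding cup_delta_def sign_cup_def by (auto intro!: prod_zero)
  qed
  then have "cochain_eval (cup_delta e n) (h' n) = 0"
    by (rule cochain_eval_eq_0)
  with odd_cup[of n] show False by simp
qed

section \<open>Borsuk-Ulam for unit spheres of Euclidean spaces\<close>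

lemma homeomorphic_space_sphere_nsphere:
  assumes "DIM('a::euclidean_space) = Suc n"
  shows "top_of_set (sphere (0::'a) 1) homeomorphic_space nsphere n"
proof -
  obtain b :: "nat \<Rightarrow> 'a" where b: "bij_betw b {..<Suc n} Basis"
    using ex_bij_betw_nat_finite[of "Basis :: 'a set"] assms by (auto simp: atLeast0LessThan)
  \<comment> \<open>\<open>nsphere n\<close> consists of sequences that vanish beyond index
    \<open>n\<close>, hence the default 0.\<close>
  define \<phi> where "\<phi> x = (\<lambda>i. if i \<le> n then x \<bullet> b i else 0)" for x :: 'a
  define \<psi> where "\<psi> z = (\<Sum>i\<le>n. z i *\<^sub>R b i)" for z :: "nat \<Rightarrow> real"
  have sumb: "(\<Sum>i\<le>n. F (b i)) = sum F Basis" for F :: "'a \<Rightarrow> 'c::comm_monoid_add"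
    using sum.reindex_bij_betw[OF b, of F] by (simp add: lessThan_Suc_atMost)
  have bb: "b i \<bullet> b j = (if i = j then 1 else 0)" if "i \<le> n" "j \<le> n" for i j
    using that inner_Basis[of "b i" "b j"] bij_betwE[OF b] bij_betw_imp_inj_on[OF b]
    by (auto simp: inj_on_def)
  have \<psi>\<phi>: "\<psi> (\<phi> x) = x" for x
    using sumb[of "\<lambda>u. (x \<bullet> u) *\<^sub>R u"] by (simp add: \<psi>_def \<phi>_def euclidean_representation)
  have \<psi>b: "\<psi> z \<bullet> b j = z j" if "j \<le> n" for z j
    using that by (simp add: \<psi>_def inner_sum_left bb if_distrib cong: if_cong)
  have norm\<phi>: "(\<Sum>i\<le>n. (x \<bullet> b i)\<^sup>2) = (norm x)\<^sup>2" for x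
    using sumb[of "\<lambda>u. (x \<bullet> u)\<^sup>2"] euclidean_inner[of x x]
    by (simp add: power2_norm_eq_inner power2_eq_square[of "_ \<bullet> _"])
  have "continuous_on UNIV \<phi>"
    unfolding \<phi>_def
    by (intro continuous_on_coordinatewise_then_product, rename_tac i, case_tac "i \<le> n") (auto intro!: continuous_intros)
  then have 1: "continuous_map (top_of_set (sphere 0 1)) (nsphere n) \<phi>"
    unfolding nsphere using norm\<phi>
    by (auto simp: continuous_map_in_subtopology euclidean_product_topology \<phi>_def intro: continuous_on_subset)
  have "continuous_on UNIV \<psi>"
    unfolding \<psi>_def by (intro continuous_intros continuous_on_product_coordinates)
  then have 2: "continuous_map (nsphere n) (top_of_set (sphere 0 1)) \<psi>"
    using norm\<phi>[of "\<psi> _"] unfolding nsphere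
    by (auto simp: continuous_map_in_subtopology euclidean_product_topology \<psi>b abs_square_eq_1 intro: continuous_on_subset)
  have 3: "\<phi> (\<psi> z) = z" if "z \<in> topspace (nsphere n)" for z
    using that by (auto simp: nsphere \<phi>_def \<psi>b)
  show ?thesis
    unfolding homeomorphic_space_def homeomorphic_maps_def using 1 2 3 \<psi>\<phi> by blast
qed

theorem Borsuk_Ulam_odd:
  fixes f :: "'a::euclidean_space \<Rightarrow> 'b::euclidean_space"
  assumes dim: "DIM('a) = Suc DIM('b)"
    and f: "continuous_on (sphere 0 1) f"
    and odd: "\<And>x. norm x = 1 \<Longrightarrow> f (- x) = - f x"
  shows "\<exists>x. norm x = 1 \<and> f x = 0"
proof -
  let ?X = "top_of_set (sphere (0::'a) 1)"
  obtain c :: "nat \<Rightarrow> 'b" where c: "bij_betw c {..<DIM('b)} Basis"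
    using ex_bij_betw_nat_finite[of "Basis :: 'b set"] by (auto simp: atLeast0LessThan)
  have "\<exists>x\<in>topspace ?X. \<forall>i<DIM('b). f x \<bullet> c i = 0"
  proof (rule Borsuk_Ulam_involution[where g = uminus])
    \<comment> \<open>A Euclidean space has dimension at least 1, which excludes the disconnected
      0-sphere.\<close>
    have "DIM('a) \<ge> 2" using dim by simp
    then show "path_connected_space ?X"
      using path_connected_sphere[of "0::'a" 1] by (simp flip: path_connectedin_def path_connectedin_topspace)
    show "topspace ?X \<noteq> {}" by simp
    show "trivial_group (homology_group (int k) ?X)" if "0 < k" "k < DIM('b)" for k
      using trivial_reduced_homology_group_nsphere[of "int k" "DIM('b)"] that
        homeomorphic_space_imp_isomorphic_reduced_homology_groups[OF homeomorphic_space_sphere_nsphere[OF dim], of "int k"]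
        isomorphic_group_triviality
      by (fastforce simp: un_reduced_homology_group)
    show "continuous_map ?X euclideanreal (\<lambda>x. f x \<bullet> c i)" for i
      using f by (auto intro!: continuous_intros)
  qed (use odd in \<open>auto intro!: continuous_intros\<close>)
  then obtain x where x: "norm x = 1" "\<And>i. i < DIM('b) \<Longrightarrow> f x \<bullet> c i = 0" by auto
  have "f x \<bullet> b = 0" if "b \<in> Basis" for b
  proof -
    from that have "b \<in> c ` {..<DIM('b)}" using c by (simp add: bij_betw_def)
    then show ?thesis using x(2) by auto
  qed
  then have "f x = 0" by (simp add: euclidean_eq_iff[of "f x"])
  with x(1) show ?thesis by blast
qed

section \<open>Complementary nonfaces\<close>

lemma realized_faceI:
  assumes "\<And>v. 0 \<le> x v" "\<And>v. v \<notin> \<sigma> \<Longrightarrow> x v = 0" "sum x \<sigma> = 1"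
  shows "x \<in> realized_face \<sigma>"
  using assms by (simp add: realized_face_def)

text \<open>A face is a closed subset of a cube, which is compact by Tychonoff's theorem.\<close>

lemma compact_realized_face:
  assumes "finite \<sigma>"
  shows "compact (realized_face \<sigma>)"
proof -
  let ?B = "(UNIV :: 'a set) \<rightarrow>\<^sub>E {0..1::real}"
  have "compactin (product_topology (\<lambda>_. euclideanreal) (UNIV :: 'a set)) ?B"
    by (simp add: compactin_PiE)
  then have "compact ?B"
    by (simp add: euclidean_product_topology)
  moreover have "closed {x :: 'a \<Rightarrow> real. 0 \<le> x v}" for v
    by (rule closed_Collect_le) auto
  then have "closed {x :: 'a \<Rightarrow> real. \<forall>v. 0 \<le> x v}"
    by (rule closed_Collect_all)
  moreover have "closed {x :: 'a \<Rightarrow> real. v \<notin> \<sigma> \<longrightarrow> x v = 0}" for v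
    by (rule closed_Collect_imp) (auto intro!: closed_Collect_eq)
  then have "closed {x :: 'a \<Rightarrow> real. \<forall>v. v \<notin> \<sigma> \<longrightarrow> x v = 0}"
    by (rule closed_Collect_all)
  moreover have "closed {x :: 'a \<Rightarrow> real. sum x \<sigma> = 1}"
    by (rule closed_Collect_eq) (auto intro!: continuous_intros)
  ultimately have "compact (?B \<inter> ({x. \<forall>v. 0 \<le> x v} \<inter> {x. \<forall>v. v \<notin> \<sigma> \<longrightarrow> x v = 0} \<inter> {x. sum x \<sigma> = 1}))"
    by (intro compact_Int_closed closed_Int)
  moreover have "realized_face \<sigma> \<subseteq> ?B"
  proof
    fix x assume x: "x \<in> realized_face \<sigma>"
    have "x v \<le> 1" for v
    proof (cases "v \<in> \<sigma>")
      case True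
      then show ?thesis
        using member_le_sum[of v \<sigma> x] x assms by (auto simp: realized_face_def)
    qed (use x in \<open>auto simp: realized_face_def\<close>)
    then show "x \<in> ?B" using x by (auto simp: realized_face_def)
  qed
  then have "realized_face \<sigma> = ?B \<inter> ({x. \<forall>v. 0 \<le> x v} \<inter> {x. \<forall>v. v \<notin> \<sigma> \<longrightarrow> x v = 0} \<inter> {x. sum x \<sigma> = 1})"
    by (auto simp: realized_face_def)
  ultimately show ?thesis by simp
qed

lemma compact_realization:
  assumes "abstract_simplicial_complex V K"
  shows "compact (realization K)"
proof -
  have "finite K" "\<And>\<sigma>. \<sigma> \<in> K \<Longrightarrow> finite \<sigma>"
    using assms finite_subset[of K "Pow V"] finite_subset[of _ V]
    by (auto simp: abstract_simplicial_complex_def)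
  then show ?thesis
    unfolding realization_def by (intro compact_UN compact_realized_face) auto
qed

text \<open>The hypotheses \<open>nz\<close> and \<open>ray\<close> say that distinct points are
  sent to distinct open rays from the origin. This form covers spherical embeddings as well as
  embeddings into a Euclidean space lifted to height 1.\<close>

lemma complementary_nonfaces:
  fixes F :: "('v \<Rightarrow> real) \<Rightarrow> 'e::euclidean_space"
  assumes K: "abstract_simplicial_complex V K" and card: "card V = DIM('e) + 2"
    and F: "continuous_on (realization K) F"
    and nz: "\<And>x. x \<in> realization K \<Longrightarrow> F x \<noteq> 0"
    and ray: "\<And>x y s t. x \<in> realization K \<Longrightarrow> y \<in> realization K \<Longrightarrow> 0 < s \<Longrightarrow> 0 < t \<Longrightarrow>
      s *\<^sub>R F x = t *\<^sub>R F y \<Longrightarrow> x = y"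
  shows "\<exists>A\<subseteq>V. A \<notin> K \<and> V - A \<notin> K"
proof (rule ccontr)
  assume "\<not> ?thesis"
  then have cov: "A \<in> K \<or> V - A \<in> K" if "A \<subseteq> V" for A using that by blast
  have fin: "finite V" and down: "\<And>\<sigma> \<tau>. \<sigma> \<in> K \<Longrightarrow> \<tau> \<subseteq> \<sigma> \<Longrightarrow> \<tau> \<in> K" and KV: "\<And>\<sigma>. \<sigma> \<in> K \<Longrightarrow> \<sigma> \<subseteq> V"
    using K by (auto simp: abstract_simplicial_complex_def)
  have finK: "finite K" using fin KV by (meson Pow_iff finite_Pow_iff finite_subset subsetI)
  \<comment> \<open>One coordinate for each vertex; the target \<open>'e \<times> real\<close> of
    the odd map \<open>f\<close> has one dimension less.\<close>
  obtain b :: "'v \<Rightarrow> 'e \<times> real \<times> real" where b: "bij_betw b V Basis"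
    using finite_same_card_bij[OF fin, of "Basis :: ('e \<times> real \<times> real) set"] card by auto
  \<comment> \<open>Coordinates of the positive part of \<open>z\<close>; the negative part is the positive part of \<open>- z\<close>.\<close>
  define p where "p z v = (if v \<in> V then max 0 (z \<bullet> b v) else 0)" for z v
  define N where "N z = (\<Sum>v\<in>V. p z v)" for z
  define S where "S z = {v\<in>V. z \<bullet> b v > 0}" for z
  define L where "L = {z. S z \<in> K}"
  define u where "u z = (\<lambda>v. p z v / N z)" for z
  define \<Phi> where "\<Phi> z = N z *\<^sub>R F (u z)" for z
  have p_nonneg: "0 \<le> p z v" for z v by (simp add: p_def)
  have N_nonneg: "0 \<le> N z" for z by (simp add: N_def sum_nonneg p_nonneg)
  have S_V: "S z \<subseteq> V" for z by (auto simp: S_def)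
  have p_S: "v \<in> S z \<longleftrightarrow> 0 < p z v" for z v by (auto simp: p_def S_def)
  have N_S: "N z = sum (p z) (S z)" for z
    unfolding N_def using fin p_S p_nonneg
    by (intro sum.mono_neutral_right) (auto simp: S_V less_le order.antisym)
  have N_pos: "0 < N z \<longleftrightarrow> S z \<noteq> {}" for z
  proof
    show "0 < N z \<Longrightarrow> S z \<noteq> {}" by (auto simp: N_S)
    show "S z \<noteq> {} \<Longrightarrow> 0 < N z"
      unfolding N_S using finite_subset[OF S_V[of z] fin] p_S[of _ z] by (intro sum_pos) auto
  qed
  have uK: "u z \<in> realization K" if "z \<in> L" "0 < N z" for z
  proof -
    have "u z \<in> realized_face (S z)"
      using that(2) p_S[of _ z] p_nonneg[of z] N_nonneg
      by (intro realized_faceI) (auto simp: u_def sum_divide_distrib[symmetric] N_S[symmetric] less_le)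
    then show ?thesis using that(1) by (auto simp: realization_def L_def)
  qed
  \<comment> \<open>That the positive support lies in a given face is a closed condition, and there
    are finitely many faces.\<close>
  have "L = (\<Union>\<sigma>\<in>K. {z. \<forall>v\<in>V - \<sigma>. z \<bullet> b v \<le> 0})"
  proof (intro equalityI subsetI)
    fix z assume "z \<in> L"
    then show "z \<in> (\<Union>\<sigma>\<in>K. {z. \<forall>v\<in>V - \<sigma>. z \<bullet> b v \<le> 0})"
      by (auto simp: L_def S_def intro!: bexI[of _ "S z"])
  next
    fix z assume "z \<in> (\<Union>\<sigma>\<in>K. {z. \<forall>v\<in>V - \<sigma>. z \<bullet> b v \<le> 0})"
    then obtain \<sigma> where "\<sigma> \<in> K" "\<forall>v\<in>V - \<sigma>. z \<bullet> b v \<le> 0" by blast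
    then have "S z \<subseteq> \<sigma>" by (force simp: S_def)
    then show "z \<in> L" using down \<open>\<sigma> \<in> K\<close> by (simp add: L_def)
  qed
  moreover have "closed \<dots>"
    using finK unfolding Ball_def
    by (intro closed_UN ballI allI impI closed_Collect_all closed_Collect_imp closed_Collect_le) (auto intro!: continuous_intros)
  ultimately have clL: "closed L" by simp
  have contp: "continuous_on T (\<lambda>z. p z v)" for v T
    unfolding p_def by (cases "v \<in> V") (auto intro!: continuous_intros)
  have contN: "continuous_on T N" for T
    unfolding N_def by (intro continuous_intros contp)
  have "compact (F ` realization K)"
    using compact_continuous_image F compact_realization[OF K] by blast
  then obtain M where M: "\<And>x. x \<in> realization K \<Longrightarrow> norm (F x) \<le> M"
    by (meson bounded_iff compact_imp_bounded imageI)
  have cont\<Phi>: "continuous_on L \<Phi>"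
    unfolding continuous_on_eq_continuous_within
  proof
    fix z assume zL: "z \<in> L"
    show "continuous (at z within L) \<Phi>"
    proof (cases "0 < N z")
      case True
      let ?U = "{z. 0 < N z}"
      have opU: "open ?U"
        by (intro open_Collect_less continuous_intros contN)
      have "continuous_on (L \<inter> ?U) u"
        unfolding u_def
        by (intro continuous_on_coordinatewise_then_product continuous_intros contp contN) auto
      then have "continuous_on (L \<inter> ?U) (\<lambda>z. F (u z))"
        using uK by (intro continuous_on_compose2[OF F]) auto
      then have "continuous_on (L \<inter> ?U) \<Phi>"
        unfolding \<Phi>_def by (intro continuous_intros contN)
      then have "continuous (at z within L \<inter> ?U) \<Phi>"
        using zL True by (simp add: continuous_on_eq_continuous_within)
      moreover have "at z within L \<inter> ?U = at z within L"
        by (rule at_within_nhd[OF _ opU]) (use True in auto)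
      ultimately show ?thesis by simp
    next
      case False
      then have Nz: "N z = 0" using N_nonneg[of z] by simp
      \<comment> \<open>Near points with \<open>N z = 0\<close> the normalization \<open>u\<close>
        is not controlled, but \<open>F\<close> is bounded on the compact realization, so
        \<open>\<Phi>\<close> tends to 0 with \<open>N\<close>.\<close>
      have le: "norm (\<Phi> y) \<le> \<bar>M\<bar> * N y" if "y \<in> L" for y
      proof (cases "0 < N y")
        case True
        then show ?thesis
          using M[OF uK[OF that True]] by (simp add: \<Phi>_def abs_of_pos)
      next
        case False
        then show ?thesis using N_nonneg[of y] by (simp add: \<Phi>_def)
      qed
      have "((\<lambda>y. \<bar>M\<bar> * N y) \<longlongrightarrow> \<bar>M\<bar> * N z) (at z within L)"
        using contN[of L] zL by (intro tendsto_intros) (auto simp: continuous_on_def)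
      then have "((\<lambda>y. \<bar>M\<bar> * N y) \<longlongrightarrow> 0) (at z within L)"
        by (simp add: Nz)
      then have "(\<Phi> \<longlongrightarrow> 0) (at z within L)"
        by (rule Lim_null_comparison[rotated]) (use le in \<open>auto simp: eventually_at_filter\<close>)
      then show ?thesis by (simp add: continuous_within \<Phi>_def Nz)
    qed
  qed
  \<comment> \<open>The odd map must be defined on the whole sphere. The values chosen outside
    \<open>L\<close> do no harm, since a zero of \<open>f\<close> on the sphere turns out to lie in
    \<open>L\<close> together with its antipode.\<close>
  obtain \<Psi> where \<Psi>: "continuous_on UNIV \<Psi>" "\<And>z. z \<in> L \<Longrightarrow> \<Psi> z = \<Phi> z"
    using Tietze_unbounded[OF cont\<Phi>, of UNIV] clL by auto
  \<comment> \<open>The last component is zero only if both parts of \<open>z\<close> are supported in \<open>K\<close>,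
    because one of the two distances is always zero.\<close>
  define f where "f z = (\<Psi> z - \<Psi> (- z), infdist z L - infdist (- z) L)" for z
  have "continuous_on UNIV f"
    unfolding f_def by (intro continuous_intros continuous_on_compose2[OF \<Psi>(1)]) auto
  then have "continuous_on (sphere 0 1) f" by (rule continuous_on_subset) simp
  moreover have "f (- z) = - f z" for z by (simp add: f_def)
  ultimately obtain z where z: "norm z = 1" "f z = 0"
    using Borsuk_Ulam_odd[of f] by auto
  have Sm: "S (- z) \<subseteq> V - S z" by (auto simp: S_def)
  have "z \<in> L \<or> - z \<in> L"
    using cov[OF S_V[of z]] down[OF _ Sm] by (auto simp: L_def)
  moreover have "infdist z L = infdist (- z) L" using z(2) by (simp add: f_def prod_eq_iff)
  ultimately have zL: "z \<in> L" "- z \<in> L"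
    using in_closed_iff_infdist_zero[OF clL, of z] in_closed_iff_infdist_zero[OF clL, of "- z"] by auto
  then have eq: "\<Phi> z = \<Phi> (- z)" using z(2) \<Psi>(2) by (simp add: f_def prod_eq_iff)
  have "S z \<noteq> {} \<or> S (- z) \<noteq> {}"
  proof (rule ccontr)
    assume "\<not> ?thesis"
    then have "z \<bullet> b v = 0" if "v \<in> V" for v using that by (force simp: S_def)
    then have "z \<bullet> i = 0" if "i \<in> b ` V" for i
      using that by auto
    then have "\<forall>i\<in>Basis. z \<bullet> i = 0"
      using bij_betw_imp_surj_on[OF b] by auto
    then have "z = 0" using euclidean_all_zero_iff by blast
    with z(1) show False by simp
  qed
  then have "0 < N z \<or> 0 < N (- z)" by (simp add: N_pos)
  \<comment> \<open>As \<open>\<Phi> z = \<Phi> (- z)\<close>, both parts of \<open>z\<close> vanish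
    or neither does.\<close>
  moreover have "0 < N y \<longleftrightarrow> \<Phi> y \<noteq> 0" if "y \<in> L" for y
    using nz[OF uK[OF that]] N_nonneg[of y] by (auto simp: \<Phi>_def)
  ultimately have pos: "0 < N z" "0 < N (- z)" using zL eq by auto
  \<comment> \<open>Equal points would have equal supports, but the positive and negative supports
    of \<open>z\<close> are disjoint and nonempty.\<close>
  have "u z = u (- z)"
    using ray[OF uK uK pos] zL pos eq by (simp add: \<Phi>_def)
  moreover obtain v where "v \<in> S z" using pos N_pos by blast
  then have "0 < u z v" "u (- z) v = 0"
    using pos by (auto simp: u_def p_S[symmetric]) (auto simp: p_def S_def)
  ultimately show False by simp
qed

section \<open>Geodesic convexity\<close>

text \<open>Equality in the spherical triangle inequality holds only on the minor arc; as
  \<open>x\<close> and \<open>y\<close> are not antipodal, this arc lies in the cone spanned by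
  them.\<close>

lemma unit_between:
  fixes x y z :: "'a::euclidean_space"
  assumes unit: "norm x = 1" "norm y = 1" "norm z = 1" and "y \<noteq> - x"
    and le: "round_dist x z + round_dist z y \<le> round_dist x y"
  obtains s t where "0 \<le> s" "0 \<le> t" "z = s *\<^sub>R x + t *\<^sub>R y"
proof -
  define \<alpha> \<beta> where "\<alpha> = arccos (x \<bullet> z)" and "\<beta> = arccos (z \<bullet> y)"
  have bd: "-1 \<le> u \<bullet> w" "u \<bullet> w \<le> 1" if "norm u = 1" "norm w = 1" for u w :: 'a
    using Cauchy_Schwarz_ineq2[of u w] that by auto
  have xx: "x \<bullet> x = 1" "y \<bullet> y = 1" "z \<bullet> z = 1"
    using unit by (simp_all add: dot_square_norm)
  have xy: "x \<bullet> y \<noteq> -1"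
  proof
    assume "x \<bullet> y = -1"
    then have "(x + y) \<bullet> (x + y) = 0" by (simp add: inner_add xx inner_commute)
    then show False using \<open>y \<noteq> - x\<close> by (simp add: add_eq_0_iff)
  qed
  have lt: "arccos (x \<bullet> y) < pi"
    using bd[OF unit(1,2)] xy arccos_less_arccos[of "-1" "x \<bullet> y"] by simp
  have cs: "cos \<alpha> = x \<bullet> z" "cos \<beta> = z \<bullet> y"
    unfolding \<alpha>_def \<beta>_def using bd unit by (auto intro!: cos_arccos)
  have rng: "0 \<le> \<alpha>" "\<alpha> \<le> pi" "0 \<le> \<beta>" "\<beta> \<le> pi"
    unfolding \<alpha>_def \<beta>_def using bd unit by (auto intro!: arccos_lbound arccos_ubound)
  have sum: "\<alpha> + \<beta> \<le> arccos (x \<bullet> y)"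
    using le by (simp add: round_dist_def \<alpha>_def \<beta>_def)
  have sn: "0 \<le> sin \<alpha>" "0 \<le> sin \<beta>"
    using rng by (auto intro: sin_ge_zero)
  have "cos (arccos (x \<bullet> y)) \<le> cos (\<alpha> + \<beta>)"
    using rng sum lt by (intro cos_monotone_0_pi_le) auto
  then have ineq: "x \<bullet> y \<le> cos \<alpha> * cos \<beta> - sin \<alpha> * sin \<beta>"
    using bd[OF unit(1,2)] by (simp add: cos_add)
  \<comment> \<open>If \<open>z\<close> lies on the arc at distances \<open>\<alpha>\<close> and
    \<open>\<beta>\<close> from its ends, spherical interpolation says that \<open>w\<close>
    vanishes. Conversely, the distance inequality forces
    \<open>w \<bullet> w \<le> 0\<close>.\<close>
  define w where "w = sin \<beta> *\<^sub>R x + sin \<alpha> *\<^sub>R y - sin (\<alpha> + \<beta>) *\<^sub>R z"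
  have "w \<bullet> w = (sin \<beta>)\<^sup>2 + (sin \<alpha>)\<^sup>2 + (sin (\<alpha> + \<beta>))\<^sup>2 + 2 * sin \<alpha> * sin \<beta> * (x \<bullet> y)
      - 2 * sin (\<alpha> + \<beta>) * (sin \<beta> * cos \<alpha> + sin \<alpha> * cos \<beta>)"
    unfolding w_def by (simp add: inner_diff inner_add xx cs inner_commute power2_eq_square algebra_simps)
  also have "\<dots> = (sin \<beta>)\<^sup>2 + (sin \<alpha>)\<^sup>2 - (sin (\<alpha> + \<beta>))\<^sup>2 + 2 * sin \<alpha> * sin \<beta> * (x \<bullet> y)"
    by (simp add: sin_add power2_eq_square algebra_simps)
  also have "\<dots> \<le> (sin \<beta>)\<^sup>2 + (sin \<alpha>)\<^sup>2 - (sin (\<alpha> + \<beta>))\<^sup>2 + 2 * sin \<alpha> * sin \<beta> * (cos \<alpha> * cos \<beta> - sin \<alpha> * sin \<beta>)"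
    using ineq sn by (intro add_left_mono mult_left_mono) auto
  also have "\<dots> = (sin \<beta>)\<^sup>2 * (1 - (cos \<alpha>)\<^sup>2) + (sin \<alpha>)\<^sup>2 * (1 - (cos \<beta>)\<^sup>2) - 2 * ((sin \<alpha>)\<^sup>2 * (sin \<beta>)\<^sup>2)"
    by (simp add: sin_add power2_eq_square algebra_simps)
  also have "\<dots> = 0"
    unfolding sin_squared_eq[symmetric] by (simp add: mult.commute)
  finally have "w = 0" by (metis inner_ge_zero inner_eq_zero_iff order.antisym)
  then have w: "sin (\<alpha> + \<beta>) *\<^sub>R z = sin \<beta> *\<^sub>R x + sin \<alpha> *\<^sub>R y" by (simp add: w_def)
  show ?thesis
  proof (cases "\<alpha> + \<beta> = 0")
    \<comment> \<open>Here \<open>sin (\<alpha> + \<beta>)\<close> is zero and cannot be divided by,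
      but \<open>z = x\<close>.\<close>
    case True
    then have "\<alpha> = 0" using rng by simp
    then have "x \<bullet> z = 1" using cs by simp
    then have "(x - z) \<bullet> (x - z) = 0" by (simp add: inner_diff xx inner_commute)
    then have "z = 1 *\<^sub>R x + 0 *\<^sub>R y" by simp
    then show ?thesis using that[of 1 0] by simp
  next
    case False
    then have pos: "0 < sin (\<alpha> + \<beta>)" using rng sum lt by (intro sin_gt_zero) auto
    have "z = (1 / sin (\<alpha> + \<beta>)) *\<^sub>R (sin (\<alpha> + \<beta>) *\<^sub>R z)" using pos by simp
    also have "\<dots> = (sin \<beta> / sin (\<alpha> + \<beta>)) *\<^sub>R x + (sin \<alpha> / sin (\<alpha> + \<beta>)) *\<^sub>R y"
      unfolding w by (simp add: scaleR_add_right)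
    finally show ?thesis using that[of "sin \<beta> / sin (\<alpha> + \<beta>)" "sin \<alpha> / sin (\<alpha> + \<beta>)"] sn pos by simp
  qed
qed

lemma round_length_leI:
  assumes "\<And>s t. 0 \<le> s \<Longrightarrow> s \<le> t \<Longrightarrow> t \<le> 1 \<Longrightarrow> round_dist (g s) (g t) \<le> c * (t - s)" "0 \<le> c"
  shows "round_length g \<le> ereal c"
  unfolding round_length_def
proof (rule SUP_least, clarify)
  fix n :: nat and t :: "nat \<Rightarrow> real"
  assume t: "mono t" "range t \<subseteq> {0..1}"
  have t01: "0 \<le> t i" "t i \<le> 1" for i using t(2) by (auto simp: image_subset_iff)
  have "(\<Sum>i<n. round_dist (g (t i)) (g (t (Suc i)))) \<le> (\<Sum>i<n. c * (t (Suc i) - t i))"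
    using t01 t(1) by (intro sum_mono assms(1)) (auto simp: mono_iff_le_Suc)
  also have "\<dots> = c * (t n - t 0)"
    by (simp add: sum_distrib_left[symmetric] sum_lessThan_telescope)
  also have "\<dots> \<le> c * 1"
    using t01[of n] t01[of 0] \<open>0 \<le> c\<close> by (intro mult_left_mono) auto
  finally show "ereal (\<Sum>i<n. round_dist (g (t i)) (g (t (Suc i)))) \<le> ereal c" by simp
qed

lemma round_length_ge:
  assumes "sphere_path x y g" "s \<in> {0..1}"
  shows "ereal (round_dist x (g s) + round_dist (g s) y) \<le> round_length g"
proof -
  \<comment> \<open>The subdivision 0, s, 1, continued by the constant 1.\<close>
  define t where "t i = (if i = 0 then 0 else if i = 1 then s else 1)" for i :: nat
  have "mono t" "range t \<subseteq> {0..1}"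
    using assms(2) by (auto simp: mono_iff_le_Suc t_def)
  then have "ereal (\<Sum>i<2. round_dist (g (t i)) (g (t (Suc i)))) \<le> round_length g"
    unfolding round_length_def by (intro SUP_upper2[of "(2, t)"]) auto
  moreover have "g 0 = x" "g 1 = y"
    using assms(1) by (auto simp: sphere_path_def pathstart_def pathfinish_def)
  ultimately show ?thesis
    by (simp add: t_def numeral_2_eq_2)
qed

text \<open>Provides the upper bound for the length of shortest paths that, with
  \<open>round_length_ge\<close>, confines them to the minor arc.\<close>

lemma sphere_path_great_arc:
  fixes x y :: "'a::euclidean_space"
  assumes unit: "norm x = 1" "norm y = 1" and ne: "y \<noteq> - x"
  obtains g where "sphere_path x y g" "round_length g \<le> ereal (round_dist x y)"
proof (cases "x = y")
  case True
  have "sphere_path x y (\<lambda>_. x)"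
    using True unit by (auto simp: sphere_path_def path_def pathstart_def pathfinish_def path_image_def)
  moreover have "round_length (\<lambda>_. x) \<le> ereal 0"
    by (rule round_length_leI) (use unit in \<open>auto simp: round_dist_def dot_square_norm\<close>)
  ultimately show ?thesis
    using that True unit by (simp add: round_dist_def dot_square_norm zero_ereal_def)
next
  case False
  define \<theta> where "\<theta> = arccos (x \<bullet> y)"
  have bd: "-1 \<le> x \<bullet> y" "x \<bullet> y \<le> 1"
    using Cauchy_Schwarz_ineq2[of x y] unit by auto
  have xx: "x \<bullet> x = 1" "y \<bullet> y = 1"
    using unit by (simp_all add: dot_square_norm)
  have "x \<bullet> y \<noteq> -1"
  proof
    assume "x \<bullet> y = -1"
    then have "(x + y) \<bullet> (x + y) = 0" by (simp add: inner_add xx inner_commute)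
    then show False using ne by (simp add: add_eq_0_iff)
  qed
  moreover have "x \<bullet> y \<noteq> 1"
  proof
    assume "x \<bullet> y = 1"
    then have "(x - y) \<bullet> (x - y) = 0" by (simp add: inner_diff xx inner_commute)
    then show False using False by simp
  qed
  ultimately have \<theta>: "0 < \<theta>" "\<theta> < pi" and c: "cos \<theta> = x \<bullet> y"
    using bd arccos_lt_bounded[of "x \<bullet> y"] by (auto simp: \<theta>_def)
  have s: "0 < sin \<theta>" using \<theta> by (rule sin_gt_zero)
  \<comment> \<open>Gram-Schmidt: the unit vector orthogonal to \<open>x\<close> in the plane of
    \<open>x\<close> and \<open>y\<close>, on the side of \<open>y\<close>.\<close>
  define e where "e = (1 / sin \<theta>) *\<^sub>R (y - cos \<theta> *\<^sub>R x)"
  have xe: "x \<bullet> e = 0" by (simp add: e_def inner_diff_right xx c)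
  have ye: "y = cos \<theta> *\<^sub>R x + sin \<theta> *\<^sub>R e" using s by (simp add: e_def)
  have "1 = (cos \<theta>)\<^sup>2 + (sin \<theta>)\<^sup>2 * (e \<bullet> e)"
    using xx(2) unfolding ye by (simp add: inner_add xx xe inner_commute[of e x] power2_eq_square algebra_simps)
  then have "(sin \<theta>)\<^sup>2 * (e \<bullet> e) = (sin \<theta>)\<^sup>2"
    using sin_cos_squared_add[of \<theta>] by linarith
  then have ee: "e \<bullet> e = 1" using s by simp
  define g where "g r = cos (\<theta> * r) *\<^sub>R x + sin (\<theta> * r) *\<^sub>R e" for r
  have gg: "g a \<bullet> g b = cos (\<theta> * b - \<theta> * a)" for a b
    by (simp add: g_def inner_add xx xe ee inner_commute[of e x] cos_diff)
  have "norm (g a) = 1" for a using gg[of a a] by (simp add: norm_eq_1)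
  then have "sphere_path x y g"
    by (auto simp: sphere_path_def path_def pathstart_def pathfinish_def path_image_def g_def ye[symmetric] intro!: continuous_intros)
  moreover have "round_length g \<le> ereal \<theta>"
  proof (rule round_length_leI)
    fix a b :: real assume ab: "0 \<le> a" "a \<le> b" "b \<le> 1"
    have "\<theta> * b - \<theta> * a = \<theta> * (b - a)" by (simp add: algebra_simps)
    moreover have "0 \<le> \<theta> * (b - a)" using \<theta> ab by simp
    moreover have "\<theta> * (b - a) \<le> pi"
      using mult_left_mono[of "b - a" 1 \<theta>] \<theta> ab by linarith
    ultimately have "arccos (cos (\<theta> * b - \<theta> * a)) = \<theta> * (b - a)"
      using arccos_cos by metis
    then show "round_dist (g a) (g b) \<le> \<theta> * (b - a)"
      by (simp add: round_dist_def gg)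
  qed (use \<theta> in simp)
  ultimately show ?thesis using that by (simp add: round_dist_def \<theta>_def)
qed

text \<open>Pointedness excludes antipodal pairs. Every point of a shortest path is then between its
  ends, hence a nonnegative combination of them.\<close>

lemma geodesically_convex_cone:
  fixes C :: "'a::euclidean_space set"
  assumes cone: "\<And>x y s t. x \<in> C \<Longrightarrow> y \<in> C \<Longrightarrow> 0 \<le> s \<Longrightarrow> 0 \<le> t \<Longrightarrow> s *\<^sub>R x + t *\<^sub>R y \<in> C"
    and pointed: "\<And>x. x \<in> C \<Longrightarrow> - x \<in> C \<Longrightarrow> x = 0"
  shows "geodesically_convex (sphere 0 1 \<inter> C)"
  unfolding geodesically_convex_def
proof (intro conjI ballI allI impI)
  fix x y g assume xy: "x \<in> sphere 0 1 \<inter> C" "y \<in> sphere 0 1 \<inter> C" and g: "shortest_sphere_path x y g"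
  have unit: "norm x = 1" "norm y = 1" using xy by auto
  have ne: "y \<noteq> - x" using pointed[of x] xy by auto
  obtain h where h: "sphere_path x y h" "round_length h \<le> ereal (round_dist x y)"
    using sphere_path_great_arc[OF unit ne] .
  have gp: "sphere_path x y g" and "round_length g \<le> round_length h"
    using g h(1) by (auto simp: shortest_sphere_path_def)
  then have len: "round_length g \<le> ereal (round_dist x y)" using h(2) by simp
  show "path_image g \<subseteq> sphere 0 1 \<inter> C"
  proof
    fix z assume z: "z \<in> path_image g"
    then obtain r where r: "r \<in> {0..1}" "z = g r" by (auto simp: path_image_def)
    have zu: "z \<in> sphere 0 1" using gp z by (auto simp: sphere_path_def)
    have "ereal (round_dist x z + round_dist z y) \<le> ereal (round_dist x y)"
      unfolding r(2) using round_length_ge[OF gp r(1)] len by (rule order_trans)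
    then have "round_dist x z + round_dist z y \<le> round_dist x y" by simp
    then obtain s t where "0 \<le> s" "0 \<le> t" "z = s *\<^sub>R x + t *\<^sub>R y"
      using unit_between[OF unit _ ne, of z] zu by auto
    then show "z \<in> sphere 0 1 \<inter> C" using cone xy zu by auto
  qed
qed auto

section \<open>Embeddings from complementary nonfaces\<close>

lemma topological_embedding_imp:
  assumes "topological_embedding K S f"
  shows "continuous_on (realization K) f" "inj_on f (realization K)" "f ` realization K \<subseteq> S"
proof -
  have h: "homeomorphic_map (top_of_set (realization K)) (subtopology (top_of_set S) (f ` realization K)) f"
    using assms by (simp add: topological_embedding_def embedding_map_def)
  show "inj_on f (realization K)"
    using homeomorphic_imp_injective_map[OF h] unfolding topspace_euclidean_subtopology .
  show "f ` realization K \<subseteq> S"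
    using homeomorphic_imp_surjective_map[OF h]
    unfolding topspace_euclidean_subtopology topspace_subtopology topspace_euclidean Int_UNIV_left
    by (rule ord_eq_le_trans) (rule Int_lower1)
  show "continuous_on (realization K) f"
    using homeomorphic_imp_continuous_map[OF h]
    unfolding continuous_map_in_subtopology continuous_map_iff_continuous by blast
qed

text \<open>A continuous map from a compact space to a Hausdorff space is closed.\<close>

lemma topological_embeddingI:
  fixes f :: "('v \<Rightarrow> real) \<Rightarrow> 'a::metric_space"
  assumes "compact (realization K)" "continuous_on (realization K) f" "inj_on f (realization K)"
    "f ` realization K \<subseteq> S"
  shows "topological_embedding K S f"
  unfolding topological_embedding_def
proof (rule injective_closed_imp_embedding_map)
  show cm: "continuous_map (top_of_set (realization K)) (top_of_set S) f"
    using assms by (auto simp: continuous_map_in_subtopology)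
  show "closed_map (top_of_set (realization K)) (top_of_set S) f"
    using assms(1) cm
    by (intro continuous_imp_closed_map) (auto simp: compact_space_subtopology intro: Hausdorff_space_subtopology)
  show "inj_on f (topspace (top_of_set (realization K)))"
    using assms(3) by simp
qed

lemma realization_iff:
  assumes K: "abstract_simplicial_complex V K"
  shows "x \<in> realization K \<longleftrightarrow>
    (\<forall>v. 0 \<le> x v) \<and> (\<forall>v. v \<notin> V \<longrightarrow> x v = 0) \<and> sum x V = 1 \<and> {v. x v \<noteq> 0} \<in> K"
    (is "?l \<longleftrightarrow> ?r")
proof -
  have fin: "finite V" and down: "\<And>\<sigma> \<tau>. \<sigma> \<in> K \<Longrightarrow> \<tau> \<subseteq> \<sigma> \<Longrightarrow> \<tau> \<in> K" and KV: "\<And>\<sigma>. \<sigma> \<in> K \<Longrightarrow> \<sigma> \<subseteq> V"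
    using K by (auto simp: abstract_simplicial_complex_def)
  have ?r if ?l
  proof -
    from that obtain \<sigma> where \<sigma>: "\<sigma> \<in> K" "\<And>v. 0 \<le> x v" "\<And>v. v \<notin> \<sigma> \<Longrightarrow> x v = 0" "sum x \<sigma> = 1"
      unfolding realization_def realized_face_def by blast
    have "sum x V = sum x \<sigma>"
      using fin KV[OF \<sigma>(1)] \<sigma>(3) by (intro sum.mono_neutral_right) auto
    moreover have "{v. x v \<noteq> 0} \<in> K" using \<sigma>(3) by (intro down[OF \<sigma>(1)]) auto
    moreover have "x v = 0" if "v \<notin> V" for v using \<sigma>(3) KV[OF \<sigma>(1)] that by blast
    ultimately show ?r using \<sigma>(2,4) by simp
  qed
  moreover have ?l if r: ?r
  proof -
    have "sum x {v. x v \<noteq> 0} = sum x V"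
      using r fin by (intro sum.mono_neutral_left) auto
    then have "x \<in> realized_face {v. x v \<noteq> 0}"
      using r by (simp add: realized_face_def)
    then show ?l using r unfolding realization_def by blast
  qed
  ultimately show ?thesis by (rule iffI)
qed

text \<open>The support of a point is a face, so it cannot contain \<open>M\<close>. The injectivity
  proofs use the nonfaces in this form.\<close>

lemma realization_avoids_nonface:
  assumes "abstract_simplicial_complex V K" "x \<in> realization K" "M \<notin> K"
  shows "\<exists>v\<in>M. x v = 0"
proof (rule ccontr)
  assume "\<not> ?thesis"
  then have "M \<subseteq> {v. x v \<noteq> 0}" by blast
  then show False
    using assms realization_iff[OF assms(1)] by (auto simp: abstract_simplicial_complex_def)
qed

section \<open>Linear maps on barycentric coordinates\<close>

text \<open>Linearity, spelled out pointwise because functions are no instance of \<open>real_vector\<close>.\<close>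

definition coord_linear :: "(('v \<Rightarrow> real) \<Rightarrow> 'e::real_vector) \<Rightarrow> bool" where
  "coord_linear P \<longleftrightarrow> (\<forall>s t x y. P (\<lambda>v. s * x v + t * y v) = s *\<^sub>R P x + t *\<^sub>R P y)"

lemma coord_linear_comb: "coord_linear P \<Longrightarrow> P (\<lambda>v. s * x v + t * y v) = s *\<^sub>R P x + t *\<^sub>R P y"
  by (simp add: coord_linear_def)

lemma coord_linear_zero: "coord_linear P \<Longrightarrow> P (\<lambda>v. 0) = 0"
  using coord_linear_comb[of P 0 "\<lambda>_. 0" 0 "\<lambda>_. 0"] by simp

lemma coord_linear_scale: "coord_linear P \<Longrightarrow> P (\<lambda>v. s * x v) = s *\<^sub>R P x"
  using coord_linear_comb[of P s x 0 "\<lambda>_. 0"] by simp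

lemma coord_linear_sum:
  assumes "coord_linear P" "finite \<sigma>"
  shows "P (\<lambda>u. \<Sum>v\<in>\<sigma>. c v * g v u) = (\<Sum>v\<in>\<sigma>. c v *\<^sub>R P (g v))"
  using assms(2)
proof (induction \<sigma> rule: finite_induct)
  case (insert w \<sigma>)
  then show ?case
    using coord_linear_comb[OF assms(1), of "c w" "g w" 1 "\<lambda>u. \<Sum>v\<in>\<sigma>. c v * g v u"] by simp
qed (simp add: coord_linear_zero[OF assms(1)])

lemma coord_linear_image_face:
  assumes P: "coord_linear P" and "finite \<sigma>"
  shows "P ` realized_face \<sigma> = convex hull (P ` vertex_point ` \<sigma>)"
proof (intro equalityI)
  show "P ` realized_face \<sigma> \<subseteq> convex hull (P ` vertex_point ` \<sigma>)"
  proof (clarify)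
    fix x assume x: "x \<in> realized_face \<sigma>"
    have "x u = (\<Sum>v\<in>\<sigma>. x v * vertex_point v u)" for u
      using x \<open>finite \<sigma>\<close> by (cases "u \<in> \<sigma>") (auto simp: vertex_point_def realized_face_def if_distrib cong: if_cong)
    then have "x = (\<lambda>u. \<Sum>v\<in>\<sigma>. x v * vertex_point v u)" by (rule ext)
    then have "P x = (\<Sum>v\<in>\<sigma>. x v *\<^sub>R P (vertex_point v))"
      using coord_linear_sum[OF assms, of x vertex_point] by simp
    moreover have "\<dots> \<in> convex hull (P ` vertex_point ` \<sigma>)"
      using x \<open>finite \<sigma>\<close> by (intro convex_sum) (auto simp: realized_face_def hull_inc)
    ultimately show "P x \<in> convex hull (P ` vertex_point ` \<sigma>)" by simp
  qed
  show "convex hull (P ` vertex_point ` \<sigma>) \<subseteq> P ` realized_face \<sigma>"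
  proof (rule hull_minimal)
    show "P ` vertex_point ` \<sigma> \<subseteq> P ` realized_face \<sigma>"
      using \<open>finite \<sigma>\<close> by (intro image_mono) (auto simp: vertex_point_def realized_face_def)
    show "convex (P ` realized_face \<sigma>)"
      unfolding convex_def
    proof (clarify)
      fix x y and s t :: real
      assume xy: "x \<in> realized_face \<sigma>" "y \<in> realized_face \<sigma>" and st: "0 \<le> s" "0 \<le> t" "s + t = 1"
      then have "(\<lambda>v. s * x v + t * y v) \<in> realized_face \<sigma>"
        unfolding realized_face_def mem_Collect_eq sum.distrib sum_distrib_left[symmetric] by simp
      then show "s *\<^sub>R P x + t *\<^sub>R P y \<in> P ` realized_face \<sigma>"
        unfolding coord_linear_comb[OF P, symmetric] by (rule imageI)
    qed
  qed
qed

section \<open>The geodesic embedding\<close>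

text \<open>The images of the vertices in \<open>A\<close> sum to zero, so do those in \<open>B\<close>, and these are the only
  linear dependencies.\<close>

lemma spherical_coord_map:
  fixes V :: "'v set"
  assumes "finite V" "V = A \<union> B" "A \<inter> B = {}" "A \<noteq> {}" "B \<noteq> {}" and card: "card V = CARD('m::finite) + 2"
  obtains P :: "('v \<Rightarrow> real) \<Rightarrow> real^'m" where "coord_linear P" "\<And>T. continuous_on T P"
    "\<And>c. P c = 0 \<longleftrightarrow> (\<exists>a b. (\<forall>v\<in>A. c v = a) \<and> (\<forall>v\<in>B. c v = b))"
    "\<And>y. \<exists>c. (\<forall>v. v \<notin> V \<longrightarrow> c v = 0) \<and> P c = y"
proof -
  obtain p q where pq: "p \<in> A" "q \<in> B" using assms by blast
  then have "p \<noteq> q" using assms by blast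
  have "card (V - {p, q}) = CARD('m)"
    using assms pq \<open>p \<noteq> q\<close> by (subst card_Diff_subset) auto
  then obtain e :: "'m \<Rightarrow> 'v" where e: "bij_betw e UNIV (V - {p, q})"
    using finite_same_card_bij[of "UNIV :: 'm set" "V - {p, q}"] \<open>finite V\<close> by auto
  have eV: "e i \<in> V - {p, q}" for i using e by (auto simp: bij_betw_def)
  \<comment> \<open>\<open>P\<close> compares each coordinate with that of the representative
    \<open>p\<close> or \<open>q\<close> of its part. This realizes the quotient by the span of the
    indicators of \<open>A\<close> and \<open>B\<close>.\<close>
  define r where "r v = (if v \<in> A then p else q)" for v
  define P :: "('v \<Rightarrow> real) \<Rightarrow> real^'m" where "P c = (\<chi> i. c (e i) - c (r (e i)))" for c
  show ?thesis
  proof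
    show "coord_linear P"
      by (auto simp: coord_linear_def P_def vec_eq_iff algebra_simps)
    show "continuous_on T P" for T
    proof (rule continuous_on_subset[of UNIV])
      show "continuous_on UNIV P"
        unfolding P_def by (intro continuous_intros) auto
    qed simp
    show "P c = 0 \<longleftrightarrow> (\<exists>a b. (\<forall>v\<in>A. c v = a) \<and> (\<forall>v\<in>B. c v = b))" for c
    proof
      assume "P c = 0"
      then have z: "c (e i) = c (r (e i))" for i by (simp add: P_def vec_eq_iff)
      have "c v = c (r v)" if v: "v \<in> V" for v
      proof (cases "v \<in> {p, q}")
        case True
        then show ?thesis using pq assms by (auto simp: r_def)
      next
        case False
        then have "v \<in> range e" using e v by (auto simp: bij_betw_def)
        then show ?thesis using z by auto
      qed
      moreover have "r v = p" if "v \<in> A" for v using that by (simp add: r_def)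
      moreover have "r v = q" if "v \<in> B" for v using that assms by (auto simp: r_def)
      ultimately show "\<exists>a b. (\<forall>v\<in>A. c v = a) \<and> (\<forall>v\<in>B. c v = b)"
        using assms(2) by (metis UnI1 UnI2)
    next
      assume "\<exists>a b. (\<forall>v\<in>A. c v = a) \<and> (\<forall>v\<in>B. c v = b)"
      then have "c (e i) = c (r (e i))" for i
        using eV[of i] pq assms by (auto simp: r_def)
      then show "P c = 0" by (simp add: P_def vec_eq_iff)
    qed
    show "\<exists>c. (\<forall>v. v \<notin> V \<longrightarrow> c v = 0) \<and> P c = y" for y
    proof (intro exI conjI)
      let ?c = "\<lambda>v. if v \<in> V - {p, q} then y $ inv_into UNIV e v else 0"
      show "\<forall>v. v \<notin> V \<longrightarrow> ?c v = 0" by simp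
      have "?c (e i) = y $ i" for i
        using eV[of i] bij_betw_imp_inj_on[OF e] by (simp add: inv_into_f_f)
      moreover have "?c (r (e i)) = 0" for i by (simp add: r_def)
      ultimately show "P ?c = y" by (simp add: P_def vec_eq_iff)
    qed
  qed
qed

text \<open>The cones spanned by the \<open>P\<close>-images of the faces of the join of the
  boundaries of \<open>A\<close> and \<open>B\<close> form a complete simplicial fan; normalizing
  turns them into spherical simplices. The sets \<open>V - {p, q}\<close> are the facets of the
  join, so if all of them belong to \<open>K\<close>, the sphere is covered.\<close>

lemma geodesic_embedding_of_nonfaces:
  fixes V :: "'v set"
  assumes K: "abstract_simplicial_complex V K" and card: "card V = CARD('m::finite) + 2"
    and V: "V = A \<union> B" "A \<inter> B = {}" and nonf: "A \<notin> K" "B \<notin> K" and "A \<noteq> {}" "B \<noteq> {}"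
  obtains f :: "('v \<Rightarrow> real) \<Rightarrow> real^'m" where "geodesic_embedding K f"
    "(\<And>p q. p \<in> A \<Longrightarrow> q \<in> B \<Longrightarrow> V - {p, q} \<in> K) \<Longrightarrow> f ` realization K = sphere 0 1"
proof -
  have fin: "finite V" and down: "\<And>\<sigma> \<tau>. \<sigma> \<in> K \<Longrightarrow> \<tau> \<subseteq> \<sigma> \<Longrightarrow> \<tau> \<in> K" and KV: "\<And>\<sigma>. \<sigma> \<in> K \<Longrightarrow> \<sigma> \<subseteq> V"
    using K by (auto simp: abstract_simplicial_complex_def)
  obtain P :: "('v \<Rightarrow> real) \<Rightarrow> real^'m" where P: "coord_linear P" "\<And>T. continuous_on T P"
    and ker: "\<And>c. P c = 0 \<longleftrightarrow> (\<exists>a b. (\<forall>v\<in>A. c v = a) \<and> (\<forall>v\<in>B. c v = b))"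
    and surj: "\<And>y. \<exists>c. (\<forall>v. v \<notin> V \<longrightarrow> c v = 0) \<and> P c = y"
    using spherical_coord_map[OF fin V \<open>A \<noteq> {}\<close> \<open>B \<noteq> {}\<close> card] by blast
  have ker_nonneg: "x v = 0" if "P x = 0" "\<And>v. 0 \<le> x v" "\<exists>v\<in>A. x v = 0" "\<exists>v\<in>B. x v = 0" "v \<in> V" for x v
    using that ker[of x] V(1) by auto
  note R = realization_iff[OF K]
  note avoid = realization_avoids_nonface[OF K]
  have nz: "P x \<noteq> 0" if x: "x \<in> realization K" for x
  proof
    assume "P x = 0"
    then have "x v = 0" if "v \<in> V" for v
      using ker_nonneg[of x v] x that avoid[OF x nonf(1)] avoid[OF x nonf(2)] by (auto simp: R)
    then have "sum x V = 0" by simp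
    then show False using x by (simp add: R)
  qed
  have ray: "x = y" if xy: "x \<in> realization K" "y \<in> realization K" and st: "0 < s" "0 < t"
    and eq: "s *\<^sub>R P x = t *\<^sub>R P y" for x y s t
  proof -
    let ?c = "\<lambda>v. s * x v + (- t) * y v"
    have "P ?c = 0" unfolding coord_linear_comb[OF P(1)] using eq by simp
    then obtain a b where ab: "\<And>v. v \<in> A \<Longrightarrow> ?c v = a" "\<And>v. v \<in> B \<Longrightarrow> ?c v = b"
      using ker[of ?c] by auto
    \<comment> \<open>The constant value is at most 0 at a vertex where \<open>x\<close> vanishes
      and at least 0 at one where \<open>y\<close> vanishes.\<close>
    have zero: "k = 0" if k: "\<And>v. v \<in> M \<Longrightarrow> ?c v = k" and M: "M \<notin> K" for k M
    proof -
      obtain v w where vw: "v \<in> M" "x v = 0" "w \<in> M" "y w = 0"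
        using avoid[OF xy(1) M] avoid[OF xy(2) M] by blast
      have "k \<le> 0" using k[OF vw(1)] vw(2) xy(2) st by (auto simp: R)
      moreover have "0 \<le> k" using k[OF vw(3)] vw(4) xy(1) st by (auto simp: R)
      ultimately show ?thesis by simp
    qed
    have "a = 0" "b = 0" using zero[OF ab(1) nonf(1)] zero[OF ab(2) nonf(2)] by auto
    then have sxy: "s * x v = t * y v" if "v \<in> V" for v
      using ab[of v] V(1) that by auto
    \<comment> \<open>Both coordinate sums are 1, so the scaling factors agree.\<close>
    then have "s * sum x V = t * sum y V" by (simp add: sum_distrib_left)
    then have "s = t" using xy by (simp add: R)
    then have "x v = y v" for v
      using sxy[of v] st xy by (cases "v \<in> V") (auto simp: R)
    then show "x = y" by (rule ext)
  qed
  define f where "f x = P x /\<^sub>R norm (P x)" for x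
  have nf: "norm (f x) = 1" if "x \<in> realization K" for x
    using nz[OF that] by (simp add: f_def)
  have scale_f: "P (\<lambda>v. s * x v) /\<^sub>R norm (P (\<lambda>v. s * x v)) = f x" if "0 < s" for s x
    using that by (simp add: coord_linear_scale[OF P(1)] f_def)
  have cf: "continuous_on (realization K) f"
    unfolding f_def using nz by (intro continuous_intros P(2)) auto
  have emb: "topological_embedding K (sphere 0 1) f"
  proof (rule topological_embeddingI[OF compact_realization[OF K] cf])
    show "inj_on f (realization K)"
    proof (rule inj_onI)
      fix x y assume "x \<in> realization K" "y \<in> realization K" "f x = f y"
      then show "x = y"
        using ray[of x y "inverse (norm (P x))" "inverse (norm (P y))"] nz by (simp add: f_def)
    qed
  qed (use nf in auto)
  have geo: "geodesically_convex (f ` realized_face \<sigma>)" if \<sigma>: "\<sigma> \<in> K" for \<sigma>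
  proof -
    \<comment> \<open>The cone over the image of the face, whose section by the sphere is the image
      under \<open>f\<close>.\<close>
    define C where "C = P ` {x. (\<forall>v. 0 \<le> x v) \<and> (\<forall>v. v \<notin> \<sigma> \<longrightarrow> x v = 0)}"
    have f\<sigma>: "finite \<sigma>" using KV[OF \<sigma>] fin finite_subset by blast
    have notsub: "\<not> A \<subseteq> \<sigma>" "\<not> B \<subseteq> \<sigma>" using down[OF \<sigma>] nonf by auto
    have "f ` realized_face \<sigma> = sphere 0 1 \<inter> C"
    proof (intro equalityI subsetI)
      fix y assume "y \<in> f ` realized_face \<sigma>"
      then obtain x where x: "x \<in> realized_face \<sigma>" "y = f x" by blast
      have "x \<in> realization K" using x \<sigma> by (auto simp: realization_def)
      then have "norm y = 1" using nf x by simp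
      moreover have "f x = P (\<lambda>v. inverse (norm (P x)) * x v)"
        by (simp add: coord_linear_scale[OF P(1)] f_def)
      then have "y \<in> C"
        unfolding C_def x(2) using x(1) by (auto simp: realized_face_def)
      ultimately show "y \<in> sphere 0 1 \<inter> C" by simp
    next
      fix y assume y: "y \<in> sphere 0 1 \<inter> C"
      then obtain x where x: "\<And>v. 0 \<le> x v" "\<And>v. v \<notin> \<sigma> \<Longrightarrow> x v = 0" "y = P x"
        by (auto simp: C_def)
      have "sum x \<sigma> \<noteq> 0"
      proof
        assume "sum x \<sigma> = 0"
        then have "x v = 0" for v
          using x f\<sigma> by (cases "v \<in> \<sigma>") (auto simp: sum_nonneg_eq_0_iff)
        then have "x = (\<lambda>_. 0)" by blast
        then show False using y x(3) coord_linear_zero[OF P(1)] by simp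
      qed
      then have s: "0 < sum x \<sigma>" using x(1) by (simp add: sum_nonneg less_le)
      let ?x = "\<lambda>v. inverse (sum x \<sigma>) * x v"
      have "?x \<in> realized_face \<sigma>"
        using x s by (auto simp: realized_face_def sum_distrib_left[symmetric])
      moreover have "f ?x = y"
        using y x(3) s by (simp add: f_def coord_linear_scale[OF P(1)])
      ultimately show "y \<in> f ` realized_face \<sigma>" by blast
    qed
    moreover have "geodesically_convex (sphere 0 1 \<inter> C)"
    proof (rule geodesically_convex_cone)
      fix x y and s t :: real assume "x \<in> C" "y \<in> C" and st: "0 \<le> s" "0 \<le> t"
      then obtain x' y' where xy: "x = P x'" "y = P y'" "\<And>v. 0 \<le> x' v" "\<And>v. 0 \<le> y' v"
        "\<And>v. v \<notin> \<sigma> \<Longrightarrow> x' v = 0" "\<And>v. v \<notin> \<sigma> \<Longrightarrow> y' v = 0"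
        by (auto simp: C_def)
      show "s *\<^sub>R x + t *\<^sub>R y \<in> C"
        unfolding C_def xy(1,2) coord_linear_comb[OF P(1), symmetric] using xy st by (intro imageI) auto
    next
      fix x assume "x \<in> C" "- x \<in> C"
      then obtain x' y' where xy: "x = P x'" "- x = P y'" "\<And>v. 0 \<le> x' v" "\<And>v. 0 \<le> y' v"
        "\<And>v. v \<notin> \<sigma> \<Longrightarrow> x' v = 0" "\<And>v. v \<notin> \<sigma> \<Longrightarrow> y' v = 0"
        by (auto simp: C_def)
      \<comment> \<open>A sum of nonnegative vectors supported on \<open>\<sigma>\<close> that lies
        in the kernel. Since \<open>\<sigma>\<close> contains neither \<open>A\<close> nor
        \<open>B\<close>, both constants of \<open>ker\<close> are 0.\<close>
      let ?c = "\<lambda>v. 1 * x' v + 1 * y' v"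
      have "P ?c = 0" unfolding coord_linear_comb[OF P(1)] by (simp flip: xy(1,2))
      moreover have "?c v = 0" if "v \<notin> \<sigma>" for v using xy(5,6) that by simp
      then have "\<exists>v\<in>A. ?c v = 0" "\<exists>v\<in>B. ?c v = 0" using notsub by blast+
      ultimately have c0: "?c v = 0" if "v \<in> V" for v
        using ker_nonneg[of ?c v] xy(3,4) that by simp
      have "x' v = 0" for v
      proof (cases "v \<in> V")
        case True
        then show ?thesis using c0[OF True] xy(3)[of v] xy(4)[of v] by linarith
      next
        case False
        then show ?thesis using KV[OF \<sigma>] xy(5)[of v] by blast
      qed
      then have "x' = (\<lambda>_. 0)" by blast
      then show "x = 0" using xy(1) coord_linear_zero[OF P(1)] by simp
    qed
    ultimately show ?thesis by simp
  qed
  show ?thesis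
  proof
    show "geodesic_embedding K f" using emb geo by (simp add: geodesic_embedding_def)
    assume full: "\<And>p q. p \<in> A \<Longrightarrow> q \<in> B \<Longrightarrow> V - {p, q} \<in> K"
    show "f ` realization K = sphere 0 1"
    proof (intro equalityI subsetI)
      fix y :: "real^'m" assume y: "y \<in> sphere 0 1"
      obtain c where c: "\<And>v. v \<notin> V \<Longrightarrow> c v = 0" "P c = y" using surj by blast
      have finAB: "finite A" "finite B" using fin V by auto
      \<comment> \<open>Subtracting the minimum on each part leaves the image unchanged and makes
        the preimage nonnegative, with zeros at \<open>p\<close> and \<open>q\<close>.\<close>
      define a b where "a = Min (c ` A)" and "b = Min (c ` B)"
      have "a \<in> c ` A" "b \<in> c ` B"
        unfolding a_def b_def using finAB \<open>A \<noteq> {}\<close> \<open>B \<noteq> {}\<close> by (auto intro!: Min_in)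
      then obtain p q where pq: "p \<in> A" "c p = a" "q \<in> B" "c q = b" by blast
      have le: "a \<le> c v" if "v \<in> A" for v using that finAB by (simp add: a_def)
      have le': "b \<le> c v" if "v \<in> B" for v using that finAB by (simp add: b_def)
      define k where "k v = (if v \<in> A then a else if v \<in> B then b else 0)" for v
      have "P k = 0" using ker[of k] V by (auto simp: k_def)
      define x where "x = (\<lambda>v. 1 * c v + (- 1) * k v)"
      have Px: "P x = y"
        unfolding x_def coord_linear_comb[OF P(1)] using \<open>P k = 0\<close> c(2) by simp
      have x0: "0 \<le> x v" for v
        using le[of v] le'[of v] c(1)[of v] V(1) by (simp add: x_def k_def)
      have xV: "x v = 0" if "v \<notin> V - {p, q}" for v
      proof -
        have "v \<notin> V \<or> v = p \<or> v = q" using that by blast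
        moreover have "q \<notin> A" using V(2) pq by blast
        ultimately show ?thesis using c(1)[of v] V(1) pq by (auto simp: x_def k_def)
      qed
      have "sum x V \<noteq> 0"
      proof
        assume "sum x V = 0"
        then have "x v = 0" for v
          using x0 xV fin by (cases "v \<in> V") (auto simp: sum_nonneg_eq_0_iff)
        then have "x = (\<lambda>_. 0)" by blast
        then show False using y Px coord_linear_zero[OF P(1)] by simp
      qed
      then have s: "0 < sum x V" using x0 by (simp add: sum_nonneg less_le)
      let ?x = "\<lambda>v. inverse (sum x V) * x v"
      have "{v. ?x v \<noteq> 0} \<subseteq> V - {p, q}" using xV by auto
      then have "{v. ?x v \<noteq> 0} \<in> K" using down full pq by blast
      then have "?x \<in> realization K"
        using x0 xV s by (auto simp: R sum_distrib_left[symmetric])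
      moreover have "f ?x = y"
        using y Px s by (simp add: f_def coord_linear_scale[OF P(1)])
      ultimately show "y \<in> f ` realization K" by blast
    qed (use nf in auto)
  qed
qed


section \<open>The linear embedding\<close>

text \<open>The affine dependencies of the images of the vertices are spanned by
  \<open>1\<^sub>A - |A| 1\<^sub>q\<close> and \<open>1\<^sub>B - |B| 1\<^sub>p\<close>. Every nonzero combination of these two vectors has constant
  sign on \<open>A\<close>, on \<open>B\<close> or on \<open>V - {p, q}\<close>.\<close>

lemma planar_coord_map:
  fixes V :: "'v set"
  assumes "finite V" "V = A \<union> B" "A \<inter> B = {}" and pq: "p \<in> A" "q \<in> B"
    and ne: "A \<noteq> {p}" "B \<noteq> {q}" and card: "card V = CARD('n::finite) + 3"
  obtains P :: "('v \<Rightarrow> real) \<Rightarrow> real^'n" where "coord_linear P" "continuous_on UNIV P"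
    "\<And>c. P c = 0 \<Longrightarrow> sum c V = 0 \<Longrightarrow> \<exists>s t. (\<forall>v\<in>A - {p}. c v = s) \<and> (\<forall>v\<in>B - {q}. c v = t) \<and>
        c p = s - real (card B) * t \<and> c q = t - real (card A) * s"
proof -
  obtain a0 b0 where ab: "a0 \<in> A" "a0 \<noteq> p" "b0 \<in> B" "b0 \<noteq> q" using pq ne by blast
  have fin: "finite A" "finite B" using assms by auto
  have dist: "a0 \<noteq> b0" "a0 \<noteq> q" "b0 \<noteq> p" "p \<noteq> q" using ab pq assms(3) by auto
  have "card (V - {a0, b0, q}) = CARD('n)"
    using assms(1,2) pq ab dist card by (subst card_Diff_subset) auto
  then obtain e :: "'n \<Rightarrow> 'v" where e: "bij_betw e UNIV (V - {a0, b0, q})"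
    using finite_same_card_bij[of "UNIV :: 'n set" "V - {a0, b0, q}"] \<open>finite V\<close> by auto
  \<comment> \<open>The equations \<open>F c w = 0\<close> determine a dependency from its values
    \<open>s = c a0\<close> and \<open>t = c b0\<close> except at \<open>q\<close>, where the
    vanishing of the total sum decides. Omitting \<open>a0\<close>, \<open>b0\<close> and
    \<open>q\<close> leaves as many equations as dimensions.\<close>
  define F where "F c w = (if w = p then c p - c a0 + card B * c b0 else if w \<in> A then c w - c a0 else c w - c b0)"
    for c :: "'v \<Rightarrow> real" and w
  define P :: "('v \<Rightarrow> real) \<Rightarrow> real^'n" where "P c = (\<chi> i. F c (e i))" for c
  show ?thesis
  proof
    show "coord_linear P"
      by (auto simp: coord_linear_def P_def F_def vec_eq_iff algebra_simps)
    have "continuous_on UNIV (\<lambda>c. F c w)" for w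
    proof (cases "w = p")
      case True
      then show ?thesis by (auto simp: F_def intro!: continuous_intros)
    next
      case False
      then show ?thesis by (cases "w \<in> A") (auto simp: F_def intro!: continuous_intros)
    qed
    then show "continuous_on UNIV P" unfolding P_def by (intro continuous_intros)
    fix c assume "P c = 0" and sum0: "sum c V = 0"
    then have "F c (e i) = 0" for i by (simp add: P_def vec_eq_iff)
    then have Fz: "F c w = 0" if "w \<in> V - {a0, b0, q}" for w
      using that bij_betw_imp_surj_on[OF e] by (metis imageE)
    have cA: "c v = c a0" if "v \<in> A - {p}" for v
      using Fz[of v] that assms(2,3) ab pq by (cases "v = a0") (auto simp: F_def)
    have cB: "c v = c b0" if "v \<in> B - {q}" for v
    proof -
      have "v \<notin> A" "v \<noteq> a0" "v \<noteq> p" using that assms(3) ab pq by auto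
      then show ?thesis
        using Fz[of v] that assms(2) by (cases "v = b0") (auto simp: F_def)
    qed
    have cp: "c p = c a0 - real (card B) * c b0"
      using Fz[of p] assms(2) ab pq dist by (auto simp: F_def)
    have "sum c A = c p + (card A - 1) * c a0"
      using sum.remove[OF fin(1) pq(1), of c] cA fin pq by (simp add: card_Diff_singleton)
    moreover have "sum c B = c q + (card B - 1) * c b0"
      using sum.remove[OF fin(2) pq(2), of c] cB fin pq by (simp add: card_Diff_singleton)
    moreover have "sum c V = sum c A + sum c B"
      unfolding assms(2) using fin assms(3) by (intro sum.union_disjoint)
    moreover have "card A \<ge> 1" "card B \<ge> 1"
      using fin pq by (auto simp: Suc_le_eq card_gt_0_iff)
    ultimately have "c q = c b0 - real (card A) * c a0"
      using sum0 cp by (simp add: of_nat_diff algebra_simps)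
    with cA cB cp show "\<exists>s t. (\<forall>v\<in>A - {p}. c v = s) \<and> (\<forall>v\<in>B - {q}. c v = t) \<and>
        c p = s - real (card B) * t \<and> c q = t - real (card A) * s"
      by blast
  qed
qed

text \<open>The difference of two points of the realization takes both weak signs on every nonface.
  A nonzero affine dependency, however, has a strict constant sign on one of the nonfaces
  \<open>A\<close>, \<open>B\<close> and \<open>V - {p, q}\<close>.\<close>

lemma linear_embedding_of_nonfaces:
  fixes V :: "'v set"
  assumes K: "abstract_simplicial_complex V K" and card: "card V = CARD('n::finite) + 3"
    and V: "V = A \<union> B" "A \<inter> B = {}" and nonf: "A \<notin> K" "B \<notin> K"
    and pq: "p \<in> A" "q \<in> B" "V - {p, q} \<notin> K"
  shows "\<exists>f :: ('v \<Rightarrow> real) \<Rightarrow> real^'n. linear_embedding K f"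
proof -
  have fin: "finite V" and KV: "\<And>\<sigma>. \<sigma> \<in> K \<Longrightarrow> \<sigma> \<subseteq> V" and vert: "\<And>v. v \<in> V \<Longrightarrow> {v} \<in> K"
    using K by (auto simp: abstract_simplicial_complex_def)
  \<comment> \<open>Single vertices are faces, so both parts contain a further vertex.\<close>
  have ne: "A \<noteq> {p}" "B \<noteq> {q}" using nonf vert pq V by auto
  obtain P :: "('v \<Rightarrow> real) \<Rightarrow> real^'n" where P: "coord_linear P" "continuous_on UNIV P"
    and ker: "\<And>c. P c = 0 \<Longrightarrow> sum c V = 0 \<Longrightarrow> \<exists>s t. (\<forall>v\<in>A - {p}. c v = s) \<and> (\<forall>v\<in>B - {q}. c v = t) \<and>
        c p = s - real (card B) * t \<and> c q = t - real (card A) * s"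
    using planar_coord_map[OF fin V pq(1,2) ne card] by blast
  have cards: "0 < card A" "0 < card B"
    using fin V pq by (auto simp: card_gt_0_iff)
  have "inj_on P (realization K)"
  proof (rule inj_onI)
    fix x y assume xy: "x \<in> realization K" "y \<in> realization K" "P x = P y"
    define c where "c = (\<lambda>v. 1 * x v + (-1) * y v)"
    have "P c = 0" unfolding c_def coord_linear_comb[OF P(1)] using xy(3) by simp
    moreover have "sum c V = 0"
      using xy(1,2) by (simp add: c_def realization_iff[OF K] sum_subtractf)
    ultimately obtain s t where st: "\<And>v. v \<in> A - {p} \<Longrightarrow> c v = s" "\<And>v. v \<in> B - {q} \<Longrightarrow> c v = t"
      "c p = s - real (card B) * t" "c q = t - real (card A) * s"
      using ker[of c] by blast
    have nonneg: "0 \<le> x v" "0 \<le> y v" for v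
      using xy(1,2) by (auto simp: realization_iff[OF K])
    \<comment> \<open>A vertex of \<open>M\<close> where \<open>x\<close> vanishes gives the first
      claim, one where \<open>y\<close> vanishes the second.\<close>
    have mixed: "\<exists>v\<in>M. c v \<le> 0" "\<exists>v\<in>M. 0 \<le> c v" if "M \<notin> K" for M
      using realization_avoids_nonface[OF K xy(1) that] realization_avoids_nonface[OF K xy(2) that] nonneg
      by (force simp: c_def)+
    have cA: "c v = (if v = p then s - real (card B) * t else s)" if "v \<in> A" for v using st that by auto
    have cB: "c v = (if v = q then t - real (card A) * s else t)" if "v \<in> B" for v using st that by auto
    have cR: "c v = s \<or> c v = t" if "v \<in> V - {p, q}" for v using st V that by blast
    have "s = 0 \<and> t = 0"
    proof (rule ccontr)
      assume "\<not> ?thesis"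
      \<comment> \<open>If \<open>s\<close> and \<open>t\<close> have the same strict sign,
        \<open>V - {p, q}\<close> decides. If \<open>s\<close> is nonzero and \<open>t\<close> does
        not share its sign, the term \<open>- card B * t\<close> reinforces \<open>s\<close> at
        \<open>p\<close>, and \<open>A\<close> decides; for \<open>s = 0\<close>, \<open>B\<close>
        does.\<close>
      then consider "0 < s" "0 < t" | "s < 0" "t < 0" | "0 < s" "t \<le> 0" | "s < 0" "0 \<le> t" | "s = 0" "0 < t" | "s = 0" "t < 0"
        by linarith
      then show False
      proof cases
        case 1 then show ?thesis using mixed(1)[OF pq(3)] cR by force
      next
        case 2 then show ?thesis using mixed(2)[OF pq(3)] cR by force
      next
        case 3
        then have "real (card B) * t \<le> 0" by (simp add: mult_nonneg_nonpos)
        moreover obtain v where "v \<in> A" "c v \<le> 0" using mixed(1)[OF nonf(1)] by blast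
        ultimately show ?thesis using cA[of v] 3 by (smt (verit))
      next
        case 4
        then have "0 \<le> real (card B) * t" by simp
        moreover obtain v where "v \<in> A" "0 \<le> c v" using mixed(2)[OF nonf(1)] by blast
        ultimately show ?thesis using cA[of v] 4 by (smt (verit))
      next
        case 5
        then show ?thesis using mixed(1)[OF nonf(2)] cB by (force split: if_splits)
      next
        case 6
        then show ?thesis using mixed(2)[OF nonf(2)] cB by (force split: if_splits)
      qed
    qed
    then have "c v = 0" if "v \<in> V" for v using cA[of v] cB[of v] V(1) that by auto
    then have "x v = y v" for v
      using xy(1,2) by (cases "v \<in> V") (auto simp: c_def realization_iff[OF K])
    then show "x = y" by (rule ext)
  qed
  then have "topological_embedding K UNIV P"
    using P(2) continuous_on_subset by (intro topological_embeddingI compact_realization[OF K]) auto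
  moreover have "P ` realized_face \<sigma> = convex hull (P ` vertex_point ` \<sigma>)" if "\<sigma> \<in> K" for \<sigma>
    using coord_linear_image_face[OF P(1)] KV[OF that] fin finite_subset by blast
  ultimately have "linear_embedding K P" by (simp add: linear_embedding_def)
  then show ?thesis by blast
qed

text \<open>A zero of the odd map \<open>g x - g (- x)\<close> is an antipodal pair with equal
  images.\<close>

lemma no_embedding_of_sphere:
  fixes g :: "'a::euclidean_space \<Rightarrow> 'b::euclidean_space"
  assumes dim: "DIM('a) = Suc DIM('b)" and g: "continuous_on (sphere 0 1) g"
  shows "\<not> inj_on g (sphere 0 1)"
proof
  assume inj: "inj_on g (sphere 0 1)"
  have "continuous_on (sphere 0 1) (\<lambda>x. g x - g (- x))"
    by (intro continuous_intros g continuous_on_compose2[OF g]) auto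
  from Borsuk_Ulam_odd[OF dim this] obtain x where x: "norm x = 1" "g x = g (- x)" by auto
  then have "x = - x" using inj by (auto simp: inj_on_def)
  then have "x = 0" by (simp add: eq_neg_iff_add_eq_0 flip: scaleR_2)
  with x(1) show False by simp
qed

section \<open>The two equivalences\<close>

theorem theorem1p4:
  fixes d :: nat and V :: "'v set" and K :: "'v set set"
  assumes "d \<ge> 1"
    and "CARD('n::finite) = d" and "CARD('m::finite) = d + 1"
    and "abstract_simplicial_complex V K" and "card V = d + 3"
  shows "((\<exists>f :: ('v \<Rightarrow> real) \<Rightarrow> real^'n. topological_embedding K UNIV f) \<longleftrightarrow>
          (\<exists>f :: ('v \<Rightarrow> real) \<Rightarrow> real^'n. linear_embedding K f)) \<and>
         ((\<exists>f :: ('v \<Rightarrow> real) \<Rightarrow> real^'m. topological_embedding K (sphere 0 1) f) \<longleftrightarrow>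
          (\<exists>f :: ('v \<Rightarrow> real) \<Rightarrow> real^'m. geodesic_embedding K f))"
proof -
  note K = assms(4)
  have V_ne: "V \<noteq> {}" using assms(5) by auto
  then have empty: "{} \<in> K" using K by (auto simp: abstract_simplicial_complex_def)
  have parts: "V = A \<union> (V - A)" "A \<inter> (V - A) = {}" "A \<noteq> {}" "V - A \<noteq> {}"
    if "A \<subseteq> V" "A \<notin> K" "V - A \<notin> K" for A
    using that empty by auto
  have "\<exists>f :: ('v \<Rightarrow> real) \<Rightarrow> real^'n. linear_embedding K f"
    if "topological_embedding K UNIV f" for f :: "('v \<Rightarrow> real) \<Rightarrow> real^'n"
  proof -
    note f = topological_embedding_imp[OF that]
    obtain A where A: "A \<subseteq> V" "A \<notin> K" "V - A \<notin> K"
    proof -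
      \<comment> \<open>At height 1, distinct points of the Euclidean space lie on distinct rays
        from the origin.\<close>
      have "continuous_on (realization K) (\<lambda>x. (f x, 1::real))"
        by (intro continuous_intros f(1))
      then have "\<exists>A\<subseteq>V. A \<notin> K \<and> V - A \<notin> K"
      proof (rule complementary_nonfaces[OF K, rotated])
        fix x y and s t :: real
        assume "x \<in> realization K" "y \<in> realization K" "0 < s" "s *\<^sub>R (f x, 1::real) = t *\<^sub>R (f y, 1)"
        then show "x = y" using f(2) by (auto simp: inj_on_def)
      qed (use assms in \<open>auto simp: zero_prod_def\<close>)
      then show ?thesis using that by blast
    qed
    show ?thesis
    proof (cases "\<exists>p\<in>A. \<exists>q\<in>V - A. V - {p, q} \<notin> K")
      case True
      then show ?thesis
        using linear_embedding_of_nonfaces[OF K _ parts(1,2)[OF A] A(2,3)] assms by auto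
    next
      \<comment> \<open>Now \<open>K\<close> is the whole join, so its realization is a sphere
        through \<open>h\<close>; composing \<open>f\<close> with the inverse of \<open>h\<close>
        would embed this sphere into a space of one dimension too few.\<close>
      case False
      obtain h :: "('v \<Rightarrow> real) \<Rightarrow> real^'m" where h: "geodesic_embedding K h" "h ` realization K = sphere 0 1"
        using geodesic_embedding_of_nonfaces[OF K _ parts(1,2)[OF A] A(2,3) parts(3,4)[OF A], where 'm = 'm] assms False
        by auto
      have "topological_embedding K (sphere 0 1) h" using h(1) by (simp add: geodesic_embedding_def)
      note h' = topological_embedding_imp[OF this]
      obtain g where g: "continuous_on (sphere 0 1) g" "\<And>x. x \<in> realization K \<Longrightarrow> g (h x) = x"
        using continuous_on_inv_into[OF h'(1) compact_realization[OF K] h'(2)] h(2) the_inv_into_f_f[OF h'(2)] by auto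
      have gR: "g y \<in> realization K" "h (g y) = y" if "y \<in> sphere 0 1" for y
        using that g(2) h(2) by (metis imageE)+
      have "inj_on (f \<circ> g) (sphere 0 1)"
        using gR f(2) by (intro inj_onI) (metis comp_apply inj_onD)
      moreover have "continuous_on (sphere 0 1) (f \<circ> g)"
        using gR by (intro continuous_on_compose g(1) continuous_on_subset[OF f(1)]) auto
      ultimately show ?thesis
        using no_embedding_of_sphere[of "f \<circ> g"] assms by auto
    qed
  qed
  moreover have "\<exists>f :: ('v \<Rightarrow> real) \<Rightarrow> real^'m. geodesic_embedding K f"
    if "topological_embedding K (sphere 0 1) f" for f :: "('v \<Rightarrow> real) \<Rightarrow> real^'m"
  proof -
    note f = topological_embedding_imp[OF that]
    have nf: "norm (f x) = 1" if "x \<in> realization K" for x using f(3) that by auto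
    have "x = y" if "x \<in> realization K" "y \<in> realization K" "0 < s" "0 < t" "s *\<^sub>R f x = t *\<^sub>R f y" for x y s t
    proof -
      \<comment> \<open>On the unit sphere, taking norms identifies the two scalars.\<close>
      have "s * norm (f x) = t * norm (f y)"
        using arg_cong[OF that(5), of norm] that(3,4) by simp
      then have "s = t" using nf that(1,2) by simp
      then show ?thesis using that f(2) by (auto simp: inj_on_def)
    qed
    moreover have "f x \<noteq> 0" if "x \<in> realization K" for x using nf[OF that] by auto
    ultimately obtain A where A: "A \<subseteq> V" "A \<notin> K" "V - A \<notin> K"
      using complementary_nonfaces[OF K _ f(1)] assms by auto
    have "card V = CARD('m) + 2" using assms by simp
    from geodesic_embedding_of_nonfaces[OF K this parts(1,2)[OF A] A(2,3) parts(3,4)[OF A]]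
    show ?thesis by blast
  qed
  \<comment> \<open>The converse implications hold because linear and geodesic embeddings are
    topological by definition.\<close>
  ultimately show ?thesis
    unfolding linear_embedding_def geodesic_embedding_def by blast
qed

end
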